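(* Let $I=\langle h_1,\ldots,h_m\rangle\subseteq\mathbb{R}[x]$ be an ideal with $V_{\mathbb{R}}(I)$ finite, let $t\ge d$ and let $y\in K_t^{\mathbb{R}}$ be such that $\operatorname{rank} M_t^{\mathbb{R}}(y)$ is maximum over $K_t^{\mathbb{R}}$. Assume that either $$\operatorname{rank} M^{\mathbb{R}}_s(y)=\operatorname{rank} M^{\mathbb{R}}_{s-1}(y)\quad\text{for some } s\ge 1 \text{ with } 2d\le s\le t,$$ or $$\operatorname{rank} M^{\mathbb{R}}_s(y)=\operatorname{rank} M^{\mathbb{R}}_{s-d}(y)\quad\text{for some } d\le s\le t.$$ Then, for such $s$, $I(V_{\mathbb{R}}(I))=\langle \operatorname{Ker} M_s^{\mathbb{R}}(y)\rangle$ and $\operatorname{rank} M_s^{\mathbb{R}}(y)=|V_{\mathbb{R}}(I)|$.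
   Context: $\mathbb{R}[x]=\mathbb{R}[x_1,\ldots,x_n]$; $V_{\mathbb{R}}(I)$ is the set of real common zeros of $I$; $I(V)$ is the ideal of polynomials in $\mathbb{R}[x]$ vanishing on $V$; $\langle A\rangle$ is the ideal generated by $A$. For $\alpha\in\mathbb{N}^n$, $|\alpha|=\sum_i\alpha_i$; $\mathbb{N}^n_t=\{\alpha:|\alpha|\le t\}$. Set $d_j:=\lceil\deg(h_j)/2\rceil$ and $d:=\max_{j=1,\ldots,m} d_j$. For $y\in\mathbb{R}^{\mathbb{N}^n_{2t}}$ and $0\le s\le t$, $M_s^{\mathbb{R}}(y)$ is the matrix indexed by $\mathbb{N}^n_s$ with $(\alpha,\beta)$ entry $y_{\alpha+\beta}$; its kernel is viewed as a set of polynomials of degree at most $s$ (a polynomial being identified with its coefficient vector). For $h=\sum_\beta h_\beta x^\beta$, the sequence $hy$ is $(hy)_\alpha=\sum_\beta h_\beta y_{\alpha+\beta}$. For $t\ge d$, $$K_t^{\mathbb{R}}:=\{y\in\mathbb{R}^{\mathbb{N}^n_{2t}} : y_0=1,\ M_t^{\mathbb{R}}(y)\succeq 0,\ M_{t-d_j}^{\mathbb{R}}(h_jy)=0\ (j=1,\ldots,m)\}.$$ *)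

theory Defs
  imports "HOL-Analysis.Analysis" "HOL-Analysis.Finite_Function_Topology"
begin

text \<open>
  The variables \<open>x\<^sub>1, \<dots>, x\<^sub>n\<close> are indexed by a finite type \<open>'n\<close>. Exponent vectors and polynomials are
  finitely supported functions: a polynomial maps each exponent to its coefficient, and its
  multiplication is the convolution product of \<^theory>\<open>HOL-Library.Poly_Mapping\<close>.
\<close>

type_synonym 'n mexp = "'n \<Rightarrow>\<^sub>0 nat"
type_synonym 'n rpoly = "'n mexp \<Rightarrow>\<^sub>0 real"

definition mdeg :: "'n::finite mexp \<Rightarrow> nat"
  where "mdeg \<alpha> = (\<Sum>i\<in>UNIV. Poly_Mapping.lookup \<alpha> i)"

definition mexps :: "nat \<Rightarrow> 'n::finite mexp set"
  where "mexps t = {\<alpha>. mdeg \<alpha> \<le> t}"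

text \<open>The zero polynomial has total degree \<open>0\<close>.\<close>

definition total_degree :: "'n::finite rpoly \<Rightarrow> nat"
  where "total_degree p = Max (insert 0 (mdeg ` Poly_Mapping.keys p))"

definition poly_eval :: "'n::finite rpoly \<Rightarrow> real ^ 'n \<Rightarrow> real"
  where "poly_eval p x =
    (\<Sum>\<alpha>\<in>Poly_Mapping.keys p. Poly_Mapping.lookup p \<alpha> * (\<Prod>i\<in>UNIV. (x $ i) ^ Poly_Mapping.lookup \<alpha> i))"

definition real_variety :: "'n::finite rpoly set \<Rightarrow> (real ^ 'n) set"
  where "real_variety I = {x. \<forall>p\<in>I. poly_eval p x = 0}"

definition vanishing_ideal :: "(real ^ 'n) set \<Rightarrow> 'n::finite rpoly set"
  where "vanishing_ideal V = {p. \<forall>x\<in>V. poly_eval p x = 0}"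

text \<open>
  The ideal generated by a set is its span in the ring regarded as a module over itself,
  written \<open>ideal.span\<close>.
\<close>

global_interpretation ideal: module "(*) :: 'a::comm_ring_1 \<Rightarrow> 'a \<Rightarrow> 'a"
  by standard (simp_all add: algebra_simps)

text \<open>
  Matrices with rows and columns indexed by a finite set \<open>A\<close> are functions of two arguments
  of which only the values on \<open>A \<times> A\<close> matter. The rank is the dimension of the column space,
  the columns being vectors supported on \<open>A\<close>.
\<close>

definition column_on :: "'a set \<Rightarrow> ('a \<Rightarrow> 'a \<Rightarrow> real) \<Rightarrow> 'a \<Rightarrow> ('a \<Rightarrow>\<^sub>0 real)"
  where "column_on A M b = (\<Sum>a\<in>A. Poly_Mapping.single a (M a b))"

definition rank_on :: "'a set \<Rightarrow> ('a \<Rightarrow> 'a \<Rightarrow> real) \<Rightarrow> nat"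
  where "rank_on A M = dim (column_on A M ` A)"

definition psd_on :: "'a set \<Rightarrow> ('a \<Rightarrow> 'a \<Rightarrow> real) \<Rightarrow> bool"
  where "psd_on A M \<longleftrightarrow> (\<forall>a\<in>A. \<forall>b\<in>A. M a b = M b a) \<and>
    (\<forall>c :: 'a \<Rightarrow> real. 0 \<le> (\<Sum>a\<in>A. \<Sum>b\<in>A. c a * M a b * c b))"

definition zero_on :: "'a set \<Rightarrow> ('a \<Rightarrow> 'a \<Rightarrow> real) \<Rightarrow> bool"
  where "zero_on A M \<longleftrightarrow> (\<forall>a\<in>A. \<forall>b\<in>A. M a b = 0)"

definition kernel_on :: "'a set \<Rightarrow> ('a \<Rightarrow> 'a \<Rightarrow> real) \<Rightarrow> ('a \<Rightarrow>\<^sub>0 real) set"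
  where "kernel_on A M =
    {p. Poly_Mapping.keys p \<subseteq> A \<and> (\<forall>a\<in>A. (\<Sum>b\<in>A. M a b * Poly_Mapping.lookup p b) = 0)}"

text \<open>
  \<open>M\<^sub>s(y)\<close> is \<open>moment_entry y\<close> on the index set \<open>mexps s\<close>. Elements of its kernel, being
  finitely supported functions on exponents, already are polynomials.
\<close>

definition moment_entry :: "('n mexp \<Rightarrow> real) \<Rightarrow> 'n mexp \<Rightarrow> 'n mexp \<Rightarrow> real"
  where "moment_entry y \<alpha> \<beta> = y (\<alpha> + \<beta>)"

definition moment_rank :: "nat \<Rightarrow> ('n::finite mexp \<Rightarrow> real) \<Rightarrow> nat"
  where "moment_rank s y = rank_on (mexps s) (moment_entry y)"

definition moment_kernel :: "nat \<Rightarrow> ('n::finite mexp \<Rightarrow> real) \<Rightarrow> 'n rpoly set"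
  where "moment_kernel s y = kernel_on (mexps s) (moment_entry y)"

text \<open>The sequence \<open>h y\<close>.\<close>

definition shift_seq :: "'n rpoly \<Rightarrow> ('n mexp \<Rightarrow> real) \<Rightarrow> 'n mexp \<Rightarrow> real"
  where "shift_seq h y \<alpha> = (\<Sum>\<beta>\<in>Poly_Mapping.keys h. Poly_Mapping.lookup h \<beta> * y (\<alpha> + \<beta>))"

definition half_deg :: "'n::finite rpoly \<Rightarrow> nat"
  where "half_deg p = nat \<lceil>real (total_degree p) / 2\<rceil>"

text \<open>Inserting \<open>0\<close> only affects \<open>m = 0\<close>, where the maximum is taken to be \<open>0\<close>.\<close>

definition max_half_deg :: "(nat \<Rightarrow> 'n::finite rpoly) \<Rightarrow> nat \<Rightarrow> nat"
  where "max_half_deg h m = Max (insert 0 ((\<lambda>j. half_deg (h j)) ` {1..m}))"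

text \<open>
  The set \<open>K\<^sub>t\<close>, meant for \<open>t \<ge> max_half_deg h m\<close> (so that the subtraction below is not truncated).
  A truncated sequence indexed by exponents of degree at most \<open>2 t\<close> is a function that is
  \<open>undefined\<close> outside that index set; none of the conditions evaluates it there.
\<close>

definition moment_feasible ::
    "(nat \<Rightarrow> 'n::finite rpoly) \<Rightarrow> nat \<Rightarrow> nat \<Rightarrow> ('n mexp \<Rightarrow> real) set"
  where "moment_feasible h m t =
    {y \<in> mexps (2 * t) \<rightarrow>\<^sub>E UNIV.
       y 0 = 1 \<and>
       psd_on (mexps t) (moment_entry y) \<and>
       (\<forall>j\<in>{1..m}. zero_on (mexps (t - half_deg (h j))) (moment_entry (shift_seq (h j) y)))}"

end

theory Submission
  imports Defs "HOL-Computational_Algebra.Fundamental_Theorem_Algebra"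
begin

text \<open>
  Write L for the linear functional that sends each monomial to its moment (\<open>riesz y\<close>). Every
  condition on y is a condition on L at polynomials of bounded degree: M_s(y) is the Gram matrix of
  the form (p, q) \<mapsto> L(p q) on polynomials of degree at most s, and the localizing condition
  says that L kills p h_j for all p of degree at most 2 (t - d_j).

  Either rank condition gives rank M_s(y) = rank M_{s-1}(y). In the second one this needs d \<ge> 1,
  which holds because otherwise all h_j are constants, feasibility forces them to vanish, and the
  variety is the infinite set \<real>^n (\<open>max_half_deg_pos\<close>). The flat extension theorem of
  Curto and Fialkow (\<open>flat_extension\<close>) then says that, up to degree 2 s, L is a positive
  combination of evaluations at the points of a finite set G, whose vanishing ideal is generated by
  Ker M_s(y) and whose cardinality is rank M_s(y). It remains to see that G is the real variety V.

  G \<subseteq> V: If 2 d \<le> s, then h_j itself lies in Ker M_s(y), hence vanishes on G. If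
  rank M_s(y) = rank M_{s-d}(y), then the interpolation polynomial r of a point g of G can be taken
  of degree at most s - d, so that r^2 h_j has degree at most 2 s and 0 = L(r^2 h_j) = w_g h_j(g),
  where w_g > 0 is the weight of g.

  V \<subseteq> G: Since y has maximal rank, the kernel of the midpoint of y and a feasible z, which lies in
  both kernels, is no smaller than the kernel of y. So the kernel of y lies in that of z
  (\<open>max_rank_kernel_subset\<close>). Taking for z the evaluation at a point of V shows that
  Ker M_s(y) vanishes there.

  The flat extension theorem is proved in two steps. Flatness makes multiplication by the variables
  commuting self-adjoint operators on polynomials of degree at most s modulo the kernel, and these
  extend L to a functional on the whole ring that is nonnegative on squares and for which every
  variable is algebraic modulo the ideal of all p with L(p^2) = 0 (\<open>flat_functional\<close>). For
  such a functional this ideal is real, so each variable satisfies an equation with simple real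
  roots, and splitting 1 into joint eigenvectors of the variables yields the points
  (\<open>positive_functional.atomic_representation\<close>).
\<close>

section \<open>Rank and nullity on finitely generated subspaces\<close>

lemma finite_basis_exists:
  fixes V :: "'a::real_vector set"
  assumes "subspace V" "finite B" "V \<subseteq> span B" "C \<subseteq> V" "independent C"
  obtains D where "C \<subseteq> D" "D \<subseteq> V" "independent D" "span D = V" "finite D" "card D = dim V"
proof -
  obtain D where D: "C \<subseteq> D" "D \<subseteq> V" "independent D" "V \<subseteq> span D"
    using maximal_independent_subset_extend[OF assms(4,5)] by blast
  have "span D = V"
    using D assms(1) by (simp add: span_minimal subset_antisym)
  moreover have "finite D"
    using independent_span_bound[OF assms(2) D(3)] D(2) assms(3) by blast
  moreover have "card D = dim V"
    using basis_card_eq_dim[OF D(2,4,3)] .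
  ultimately show thesis using that D by blast
qed

lemma subspace_kernel_on:
  assumes "subspace V" "linear f"
  shows "subspace {x\<in>V. f x = 0}"
  using subspace_inter[OF assms(1) linear_subspace_kernel[OF assms(2)]] by (simp add: Int_def)

text \<open>
  The ambient space of polynomials has infinite dimension, so dimensions are compared inside the span
  of a finite set.
\<close>

lemma rank_nullity:
  fixes V :: "'a::real_vector set" and f :: "'a \<Rightarrow> 'b::real_vector"
  assumes V: "subspace V" and B: "finite B" "V \<subseteq> span B" and f: "linear f"
  shows "dim (f ` V) + dim {x\<in>V. f x = 0} = dim V"
proof -
  let ?K = "{x\<in>V. f x = 0}"
  obtain C where C: "C \<subseteq> ?K" "independent C" "span C = ?K" "finite C" "card C = dim ?K"
    using finite_basis_exists[OF subspace_kernel_on[OF V f] B(1), of "{}"] B(2) by (auto simp: independent_empty)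
  obtain D where D: "C \<subseteq> D" "D \<subseteq> V" "independent D" "span D = V" "finite D" "card D = dim V"
    using finite_basis_exists[OF V B, of C] C by auto
  \<comment> \<open>\<open>C\<close> and \<open>D - C\<close> are complementary parts of the basis \<open>D\<close>, so their spans meet only in \<open>0\<close>.\<close>
  have trivial: "x = 0" if x: "x \<in> span (D - C)" "f x = 0" for x
  proof -
    have "x \<in> span C"
      using x D(4) span_mono[of "D - C" D] C(3) by auto
    then have "representation D x b = 0" for b
      using representation_extend[OF D(3) x(1)] representation_extend[OF D(3), of x C] D(1)
        representation_ne_zero[of C x b] representation_ne_zero[of "D - C" x b] by auto
    moreover have "x \<in> span D"
      using x(1) span_mono[of "D - C" D] by auto
    ultimately show "x = 0"
      using sum_nonzero_representation_eq[OF D(3), of x] by simp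
  qed
  have inj: "inj_on f (span (D - C))"
    using trivial linear_injective_on_subspace_0[OF f subspace_span] by blast
  have "f ` V = span (f ` (D - C))"
  proof
    show "span (f ` (D - C)) \<subseteq> f ` V"
      using D(2) linear_span_image[OF f, of "D - C"] D(4) span_mono[of "D - C" D] by auto
    have "f ` D \<subseteq> span (f ` (D - C))"
    proof
      fix z assume "z \<in> f ` D"
      then obtain b where "b \<in> D" "z = f b" by blast
      then show "z \<in> span (f ` (D - C))"
        using C(1) by (cases "b \<in> C") (auto simp: span_zero span_base)
    qed
    then show "f ` V \<subseteq> span (f ` (D - C))"
      using D(4) linear_span_image[OF f, of D] by (metis span_minimal subspace_span)
  qed
  then have "dim (f ` V) = dim (f ` (D - C))" by simp
  also have "\<dots> = card (f ` (D - C))"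
    using D(3) linear_dependent_inj_imageD[OF f _ inj] independent_mono[of D "D - C"]
    by (auto intro!: dim_eq_card_independent)
  also have "\<dots> = card (D - C)"
    using inj inj_on_subset[OF _ span_superset] card_image by blast
  also have "\<dots> = card D - card C"
    by (rule card_Diff_subset[OF C(4) D(1)])
  finally show ?thesis
    using C(5) D(6) card_mono[OF D(5,1)] by linarith
qed

lemma subspace_eqI_dim:
  fixes S V :: "'a::real_vector set"
  assumes "subspace S" "subspace V" "S \<subseteq> V" "finite B" "V \<subseteq> span B" "dim S = dim V"
  shows "S = V"
proof -
  obtain C where C: "C \<subseteq> S" "independent C" "span C = S" "finite C" "card C = dim S"
    by (rule finite_basis_exists[OF assms(1,4) order_trans[OF assms(3,5)] empty_subsetI
          independent_empty]) (rule that)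
  obtain D where D: "C \<subseteq> D" "D \<subseteq> V" "independent D" "span D = V" "finite D" "card D = dim V"
    by (rule finite_basis_exists[OF assms(2,4,5) order_trans[OF C(1) assms(3)] C(2)])
      (rule that)
  have "C = D"
    using card_subset_eq[OF D(5,1)] C(5) D(6) assms(6) by simp
  then show ?thesis using C(3) D(4) by simp
qed

lemma dim_mono_finite:
  fixes S V :: "'a::real_vector set"
  assumes "S \<subseteq> V" "finite B" "V \<subseteq> span B"
  shows "dim S \<le> dim V"
proof -
  have sS: "span S \<subseteq> span B"
    using assms by (simp add: span_minimal)
  obtain C where C: "span C = span S" "independent C" "C \<subseteq> span S" "card C = dim S"
    by (rule finite_basis_exists[OF subspace_span assms(2) sS empty_subsetI independent_empty])
      (rule that, auto)
  have sp: "span V \<subseteq> span B"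
    using assms(3) by (simp add: span_minimal)
  obtain D where D: "C \<subseteq> D" "finite D" "card D = dim V"
    by (rule finite_basis_exists[OF subspace_span assms(2) sp
          order_trans[OF C(3) span_mono[OF assms(1)]] C(2)]) (rule that, auto)
  show ?thesis
    using card_mono[OF D(2,1)] C(4) D(3) by simp
qed

(* The interpretation of rings as modules over themselves makes a * (b * x) = a * b * x a
   simplification rule, which loops with mult.assoc, ac_simps and algebra_simps. *)
declare ideal.scale_scale [simp del]

section \<open>Polynomials as finitely supported functions\<close>

lemma lookup_scaleR [simp]:
  "Poly_Mapping.lookup (r *\<^sub>R p) k = r *\<^sub>R Poly_Mapping.lookup p k"
  by (simp add: scaleR_poly_mapping_def)

instance poly_mapping :: (comm_monoid_add, "{real_algebra_1, comm_ring_1}") real_algebra_1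
proof
  fix r :: real and p q :: "'a \<Rightarrow>\<^sub>0 'b"
  have scale: "r *\<^sub>R p = Poly_Mapping.single 0 (of_real r) * p" for p :: "'a \<Rightarrow>\<^sub>0 'b"
    unfolding mult_map_scale_conv_mult[symmetric]
    by (rule poly_mapping_eqI) (simp add: Poly_Mapping.map.rep_eq when_def of_real_def)
  show "r *\<^sub>R p * q = r *\<^sub>R (p * q)"
    by (simp only: scale mult.assoc)
  show "p * r *\<^sub>R q = r *\<^sub>R (p * q)"
    by (simp only: scale mult.left_commute)
qed

abbreviation monomial :: "'a \<Rightarrow> ('a \<Rightarrow>\<^sub>0 real)"
  where "monomial \<alpha> \<equiv> Poly_Mapping.single \<alpha> 1"

text \<open>
  The linear map with prescribed values on monomials. Evaluation at a point, the functional of a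
  moment sequence and the reduction to normal forms below are all of this shape.
\<close>

definition lin_ext :: "('a \<Rightarrow> 'b::real_vector) \<Rightarrow> ('a \<Rightarrow>\<^sub>0 real) \<Rightarrow> 'b"
  where "lin_ext f p = (\<Sum>\<alpha>\<in>Poly_Mapping.keys p. Poly_Mapping.lookup p \<alpha> *\<^sub>R f \<alpha>)"

lemma lin_ext_superset:
  assumes "finite A" "Poly_Mapping.keys p \<subseteq> A"
  shows "lin_ext f p = (\<Sum>\<alpha>\<in>A. Poly_Mapping.lookup p \<alpha> *\<^sub>R f \<alpha>)"
  unfolding lin_ext_def by (rule sum.mono_neutral_left) (use assms in \<open>auto simp: in_keys_iff\<close>)

lemma lin_ext_single [simp]: "lin_ext f (Poly_Mapping.single \<alpha> c) = c *\<^sub>R f \<alpha>"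
  by (simp add: lin_ext_def)

lemma linear_lin_ext: "linear (lin_ext f)"
proof (rule linearI)
  fix p q :: "'a \<Rightarrow>\<^sub>0 real" and c :: real
  show "lin_ext f (p + q) = lin_ext f p + lin_ext f q"
    unfolding lin_ext_def
    by (rule setsum_keys_plus_distrib) (simp_all add: scaleR_add_left)
  have "lin_ext f (c *\<^sub>R p) = (\<Sum>\<alpha>\<in>Poly_Mapping.keys p. (c * Poly_Mapping.lookup p \<alpha>) *\<^sub>R f \<alpha>)"
    by (subst lin_ext_superset[of "Poly_Mapping.keys p"]) (auto simp: in_keys_iff)
  then show "lin_ext f (c *\<^sub>R p) = c *\<^sub>R lin_ext f p"
    by (simp add: lin_ext_def scaleR_sum_right)
qed

lemma monom_expansion:
  fixes p :: "'a \<Rightarrow>\<^sub>0 real"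
  shows
  "p = (\<Sum>\<alpha>\<in>Poly_Mapping.keys p. Poly_Mapping.lookup p \<alpha> *\<^sub>R monomial \<alpha>)"
  by (rule poly_mapping_eqI)
    (auto simp: lookup_sum lookup_single when_def in_keys_iff sum.delta' if_distrib
          cong: if_cong)

lemma span_monom: "{p :: 'a \<Rightarrow>\<^sub>0 real. Poly_Mapping.keys p \<subseteq> A} = span (monomial ` A)"
proof
  show "{p. Poly_Mapping.keys p \<subseteq> A} \<subseteq> span (monomial ` A)"
  proof
    fix p :: "'a \<Rightarrow>\<^sub>0 real" assume "p \<in> {p. Poly_Mapping.keys p \<subseteq> A}"
    then have "(\<Sum>\<alpha>\<in>Poly_Mapping.keys p. Poly_Mapping.lookup p \<alpha> *\<^sub>R monomial \<alpha>) \<in> span (monomial ` A)"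
      by (intro span_sum span_mul span_base) auto
    then show "p \<in> span (monomial ` A)"
      using monom_expansion[of p] by simp
  qed
  have "subspace {p::'a \<Rightarrow>\<^sub>0 real. Poly_Mapping.keys p \<subseteq> A}"
    by (rule subspaceI) (auto simp: in_keys_iff dest!: subsetD[OF keys_add])
  then show "span (monomial ` A) \<subseteq> {p. Poly_Mapping.keys p \<subseteq> A}"
    by (intro span_minimal) auto
qed

lemma linear_eq_on_monom:
  assumes "linear f" "linear g" "\<And>\<alpha>. \<alpha> \<in> Poly_Mapping.keys p \<Longrightarrow> f (monomial \<alpha>) = g (monomial \<alpha>)"
  shows "f p = g p"
  by (rule linear_eq_on[OF assms(1,2), of p "monomial ` Poly_Mapping.keys p"])
    (use span_monom[of "Poly_Mapping.keys p"] assms(3) in auto)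

lemma linear_mult_left: "linear (\<lambda>p::'n::finite rpoly. q * p)"
  and linear_mult_right: "linear (\<lambda>p::'n::finite rpoly. p * q)"
  by (auto intro!: linearI simp: algebra_simps)

abbreviation Var :: "'n \<Rightarrow> 'n::finite rpoly"
  where "Var i \<equiv> monomial (Poly_Mapping.single i (Suc 0))"

lemma mdeg_zero [simp]: "mdeg 0 = 0"
  by (simp add: mdeg_def)

lemma mdeg_add: "mdeg (\<alpha> + \<beta>) = mdeg \<alpha> + mdeg \<beta>"
  by (simp add: mdeg_def lookup_add sum.distrib)

lemma mdeg_single [simp]: "mdeg (Poly_Mapping.single i k) = k"
  by (simp add: mdeg_def lookup_single when_def)

lemma mexp_diff_single:
  fixes \<alpha> :: "'n mexp"
  assumes "Poly_Mapping.lookup \<alpha> i \<noteq> 0"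
  shows "\<alpha> = \<alpha> - Poly_Mapping.single i (Suc 0) + Poly_Mapping.single i (Suc 0)"
  using assms by (intro poly_mapping_eqI) (auto simp: lookup_add lookup_minus lookup_single when_def)

lemma mexp_induct [case_names zero add]:
  assumes "P 0" "\<And>\<beta> i. P \<beta> \<Longrightarrow> P (\<beta> + Poly_Mapping.single i (Suc 0))"
  shows "P (\<alpha> :: 'n::finite mexp)"
proof (induction "mdeg \<alpha>" arbitrary: \<alpha> rule: less_induct)
  case less
  show ?case
  proof (cases "\<alpha> = 0")
    case False
    then obtain i where "Poly_Mapping.lookup \<alpha> i \<noteq> 0"
      by (metis lookup_zero poly_mapping_eqI)
    from mexp_diff_single[OF this] obtain \<beta> where "\<alpha> = \<beta> + Poly_Mapping.single i (Suc 0)" ..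
    then show ?thesis using less[of \<beta>] assms(2) by (simp add: mdeg_add)
  qed (use assms(1) in simp)
qed

lemma monom_add: "monomial (\<alpha> + \<beta>) = monomial \<alpha> * monomial \<beta>"
  by (simp add: mult_single)

lemma rpoly_induct [case_names const add Var_mult]:
  assumes const: "\<And>c. P (c *\<^sub>R 1)"
    and add: "\<And>p q. P p \<Longrightarrow> P q \<Longrightarrow> P (p + q)"
    and var: "\<And>i p. P p \<Longrightarrow> P (Var i * p)"
  shows "P (p :: 'n::finite rpoly)"
proof -
  have mono: "P (c *\<^sub>R monomial \<alpha>)" for c \<alpha>
  proof (induction \<alpha> rule: mexp_induct)
    case zero
    then show ?case using const[of c] by simp
  next
    case (add \<beta> i)
    then show ?case using var[OF add, of i] by (simp add: monom_add mult.commute)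
  qed
  have "P (\<Sum>\<alpha>\<in>A. Poly_Mapping.lookup p \<alpha> *\<^sub>R monomial \<alpha>)" if "finite A" for A
    using that by induction (use const[of 0] mono add in auto)
  from this[OF finite_keys] show ?thesis
    by (subst monom_expansion)
qed

lemma finite_mexps: "finite (mexps s :: 'n::finite mexp set)"
proof -
  have "Poly_Mapping.lookup \<alpha> i \<le> mdeg \<alpha>" for \<alpha> :: "'n mexp" and i
    unfolding mdeg_def by (rule member_le_sum) auto
  then have "Poly_Mapping.lookup ` (mexps s :: 'n mexp set) \<subseteq> UNIV \<rightarrow>\<^sub>E {..s}"
    by (auto simp: mexps_def PiE_def intro: order_trans)
  then have "finite (Poly_Mapping.lookup ` (mexps s :: 'n mexp set))"
    by (rule finite_subset) (simp add: finite_PiE)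
  then show ?thesis
    by (rule finite_imageD) (auto intro: inj_onI poly_mapping_eqI)
qed

lemma zero_in_mexps [simp]: "0 \<in> mexps s"
  by (simp add: mexps_def)

lemma mexps_mono: "a \<le> b \<Longrightarrow> mexps a \<subseteq> mexps b"
  by (auto simp: mexps_def)

lemma mexps_add: "\<alpha> \<in> mexps a \<Longrightarrow> \<beta> \<in> mexps b \<Longrightarrow> \<alpha> + \<beta> \<in> mexps (a + b)"
  by (simp add: mexps_def mdeg_add)

text \<open>
  With \<open>a = b = s\<close> this is why the moment matrix of order \<open>s\<close> determines a functional up to degree
  \<open>2 s\<close>.
\<close>

lemma mexps_add_split:
  assumes "\<gamma> \<in> mexps (a + b)"
  obtains \<alpha> \<beta> where "\<alpha> \<in> mexps a" "\<beta> \<in> mexps b" "\<gamma> = \<alpha> + \<beta>"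
proof -
  have "\<exists>\<alpha>\<in>mexps a. \<exists>\<beta>\<in>mexps b. \<gamma> = \<alpha> + \<beta>"
    using assms
  proof (induction \<gamma> arbitrary: a b rule: mexp_induct)
    case (add \<beta> i)
    then have deg: "mdeg \<beta> + 1 \<le> a + b" by (simp add: mexps_def mdeg_add)
    show ?case
    proof (cases "a = 0")
      case True
      then show ?thesis using add.prems by (intro bexI[of _ 0] bexI[of _ "\<beta> + Poly_Mapping.single i (Suc 0)"]) auto
    next
      case False
      then have "\<beta> \<in> mexps (a - 1 + b)" using deg by (simp add: mexps_def)
      from add.IH[OF this] obtain \<alpha>' \<beta>' where
        *: "\<alpha>' \<in> mexps (a - 1)" "\<beta>' \<in> mexps b" "\<beta> = \<alpha>' + \<beta>'" by blast
      then have "\<alpha>' + Poly_Mapping.single i (Suc 0) \<in> mexps a"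
        using False by (simp add: mexps_def mdeg_add)
      then show ?thesis using * by (metis add.assoc add.commute)
    qed
  qed (auto intro!: bexI[of _ 0])
  then show thesis using that by blast
qed

definition polys_upto :: "nat \<Rightarrow> 'n::finite rpoly set"
  where "polys_upto s = {p. Poly_Mapping.keys p \<subseteq> mexps s}"

lemma polys_upto_span: "polys_upto s = span (monomial ` mexps s)"
  unfolding polys_upto_def by (rule span_monom)

lemma subspace_polys_upto [simp]: "subspace (polys_upto s)"
  by (simp add: polys_upto_span)

lemma finite_monoms: "finite (monomial ` mexps s :: 'n::finite rpoly set)"
  by (simp add: finite_mexps)

lemma polys_upto_subset_span: "polys_upto s \<subseteq> span (monomial ` mexps s)"
  by (simp add: polys_upto_span)

lemma polys_upto_mono: "a \<le> b \<Longrightarrow> polys_upto a \<subseteq> polys_upto b"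
  using mexps_mono[of a b] by (auto simp: polys_upto_def)

lemma monom_in_polys_upto: "\<alpha> \<in> mexps s \<Longrightarrow> monomial \<alpha> \<in> polys_upto s"
  by (simp add: polys_upto_def)

lemma one_in_polys_upto [simp]: "1 \<in> polys_upto s"
  by (simp add: polys_upto_def)

lemma mult_in_polys_upto:
  assumes "p \<in> polys_upto a" "q \<in> polys_upto b"
  shows "p * q \<in> polys_upto (a + b)"
  using assms keys_mult[of p q] mexps_add unfolding polys_upto_def by blast

lemma square_in_polys_upto: "p \<in> polys_upto s \<Longrightarrow> p * p \<in> polys_upto (2 * s)"
  using mult_in_polys_upto[of p s p s] by (simp add: mult_2)

lemma polys_upto_total_degree: "p \<in> polys_upto (total_degree p)"
  by (auto simp: polys_upto_def mexps_def total_degree_def intro!: Max_ge)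

lemma linear_eq_on_polys_upto:
  assumes "linear f" "linear g" "\<And>\<alpha>. \<alpha> \<in> mexps s \<Longrightarrow> f (monomial \<alpha>) = g (monomial \<alpha>)"
    and "p \<in> polys_upto s"
  shows "f p = g p"
  by (rule linear_eq_on_monom[OF assms(1,2)]) (use assms(3,4) in \<open>auto simp: polys_upto_def\<close>)

text \<open>The moment sequence of the point mass at \<open>x\<close>.\<close>

definition monom_eval :: "real ^ 'n \<Rightarrow> 'n::finite mexp \<Rightarrow> real"
  where "monom_eval x \<alpha> = (\<Prod>i\<in>UNIV. (x $ i) ^ Poly_Mapping.lookup \<alpha> i)"

lemma poly_eval_lin_ext: "poly_eval p x = lin_ext (monom_eval x) p"
  by (simp add: poly_eval_def lin_ext_def monom_eval_def)

lemma linear_poly_eval: "linear (\<lambda>p. poly_eval p x)"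
  unfolding poly_eval_lin_ext by (rule linear_lin_ext)

lemmas poly_eval_add [simp] = linear_add[OF linear_poly_eval]
  and poly_eval_diff [simp] = linear_diff[OF linear_poly_eval]
  and poly_eval_scaleR [simp] = linear_scale[OF linear_poly_eval]
  and poly_eval_zero [simp] = linear_0[OF linear_poly_eval]

lemma poly_eval_monom: "poly_eval (monomial \<alpha>) x = monom_eval x \<alpha>"
  by (simp add: poly_eval_lin_ext)

lemma poly_eval_one [simp]: "poly_eval 1 x = 1"
  using poly_eval_monom[of 0 x] by (simp add: monom_eval_def)

lemma poly_eval_Var [simp]: "poly_eval (Var i) x = x $ i"
  by (subst poly_eval_monom)
    (simp add: monom_eval_def lookup_single when_def if_distrib prod.delta cong: if_cong)

lemma poly_eval_mult [simp]: "poly_eval (p * q) x = poly_eval p x * poly_eval q x"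
proof -
  have m: "poly_eval (monomial \<alpha> * monomial \<beta>) x = poly_eval (monomial \<alpha>) x * poly_eval (monomial \<beta>) x" for \<alpha> \<beta>
    by (simp only: monom_add[symmetric] poly_eval_monom)
      (simp add: monom_eval_def lookup_add power_add prod.distrib)
  have l: "linear (\<lambda>q. poly_eval (p * q) x)" "linear (\<lambda>q. poly_eval p x * poly_eval q x)"
          "linear (\<lambda>p. poly_eval (p * q) x)" "linear (\<lambda>p. poly_eval p x * poly_eval q x)" for p q :: "'a rpoly"
    by (rule linearI; simp add: distrib_left distrib_right)+
  have "poly_eval (p * monomial \<beta>) x = poly_eval p x * poly_eval (monomial \<beta>) x" for p \<beta>
    by (rule linear_eq_on_monom[OF l(3,4)]) (rule m)
  then show ?thesis
    by (rule linear_eq_on_monom[OF l(1,2)])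
qed

lemma poly_eval_prod [simp]: "poly_eval (prod f A) x = (\<Prod>a\<in>A. poly_eval (f a) x)"
  by (induction A rule: infinite_finite_induct) auto

lemma interpolation_polynomial:
  fixes G :: "(real ^ 'n::finite) set"
  assumes "finite G"
  obtains e where "\<And>g. g \<in> G \<Longrightarrow> poly_eval e g = (if g = w then 1 else 0)"
proof -
  have "\<exists>e. poly_eval e w = 1 \<and> poly_eval e g = 0" if "g \<noteq> w" for g
  proof -
    obtain i where i: "g $ i \<noteq> w $ i" using \<open>g \<noteq> w\<close> by (auto simp: vec_eq_iff)
    have "poly_eval ((1 / (w $ i - g $ i)) *\<^sub>R (Var i - (g $ i) *\<^sub>R 1)) x
        = (x $ i - g $ i) / (w $ i - g $ i)" for x
      by (simp del: One_nat_def)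
    then show ?thesis using i by (metis diff_self div_0 divide_self_if eq_iff_diff_eq_0)
  qed
  then obtain e where e: "\<And>g. g \<noteq> w \<Longrightarrow> poly_eval (e g) w = 1 \<and> poly_eval (e g) g = 0"
    by metis
  have "poly_eval (\<Prod>g\<in>G-{w}. e g) g = (if g = w then 1 else 0)" if "g \<in> G" for g
    using that e assms by (auto simp: prod_zero_iff intro!: prod.neutral)
  then show thesis using that by blast
qed

section \<open>Real univariate polynomials at elements of a real algebra\<close>

definition real_poly_at :: "real poly \<Rightarrow> 'a::{real_algebra_1, comm_ring_1} \<Rightarrow> 'a"
  where "real_poly_at u x = poly (map_poly of_real u) x"

lemma real_poly_at_0 [simp]: "real_poly_at 0 x = 0"
  by (simp add: real_poly_at_def)

lemma real_poly_at_pCons [simp]: "real_poly_at (pCons a u) x = of_real a + x * real_poly_at u x"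
  by (cases "pCons a u = 0") (auto simp: real_poly_at_def map_poly_pCons)

lemma real_poly_at_add [simp]: "real_poly_at (u + v) x = real_poly_at u x + real_poly_at v x"
  by (induction u v rule: poly_induct2) (simp_all add: algebra_simps)

lemma real_poly_at_smult [simp]: "real_poly_at (smult c u) x = of_real c * real_poly_at u x"
  by (induction u) (simp_all add: algebra_simps)

lemma real_poly_at_mult [simp]: "real_poly_at (u * v) x = real_poly_at u x * real_poly_at v x"
  by (induction u) (simp_all add: algebra_simps)

lemma real_poly_at_monom: "real_poly_at (Polynomial.monom c k) x = c *\<^sub>R x ^ k"
  by (induction k) (simp_all add: monom_0 monom_Suc of_real_def)

lemma real_poly_at_sum: "real_poly_at (sum f A) x = (\<Sum>a\<in>A. real_poly_at (f a) x)"
  by (induction A rule: infinite_finite_induct) simp_all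

text \<open>
  A complex root \<open>a + i b\<close> gives the real factor \<open>(X - a)\<^sup>2 + b\<^sup>2\<close>. The quadratic is kept in this
  form because a nonnegative functional treats it as a sum of two squares.
\<close>

lemma real_poly_factor:
  fixes u :: "real poly"
  assumes "degree u > 0"
  shows "(\<exists>a. [:- a, 1:] dvd u) \<or> (\<exists>a b. b \<noteq> 0 \<and> [:- a, 1:] * [:- a, 1:] + [:b * b:] dvd u)"
proof -
  have "degree (map_poly complex_of_real u) = degree u"
    by (rule degree_map_poly) simp
  then have "\<not> constant (poly (map_poly complex_of_real u))"
    using assms by (simp add: constant_degree)
  then obtain z :: complex where z: "real_poly_at u z = 0"
    using fundamental_theorem_of_algebra unfolding real_poly_at_def by blast
  show ?thesis
  proof (cases "Im z = 0")
    case True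
    then have "z = of_real (Re z)"
      by (simp add: complex_eq_iff)
    moreover have "real_poly_at u (complex_of_real a) = of_real (poly u a)" for a
      by (induction u) simp_all
    ultimately have "poly u (Re z) = 0"
      using z by (metis of_real_eq_0_iff)
    then show ?thesis by (auto simp: poly_eq_0_iff_dvd)
  next
    case False
    define g where "g = [:- Re z, 1:] * [:- Re z, 1:] + [:Im z * Im z:]"
    have g: "g = [:Re z * Re z + Im z * Im z, - 2 * Re z, 1:]"
      by (simp add: g_def)
    have "real_poly_at g z = 0"
      unfolding g by (simp add: complex_eq_iff algebra_simps)
    moreover have "real_poly_at u z = real_poly_at (u div g) z * real_poly_at g z + real_poly_at (u mod g) z"
      by (metis div_mult_mod_eq real_poly_at_add real_poly_at_mult)
    ultimately have "real_poly_at (u mod g) z = 0"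
      using z by simp
    moreover have "degree (u mod g) < 2"
      using degree_mod_less'[of g u] by (cases "u mod g = 0") (auto simp: g)
    then have r: "u mod g = [:coeff (u mod g) 0, coeff (u mod g) 1:]"
      by (intro poly_eqI) (auto simp: coeff_pCons coeff_eq_0 split: nat.splits)
    ultimately have "real_poly_at [:coeff (u mod g) 0, coeff (u mod g) 1:] z = 0"
      by simp
    then have "coeff (u mod g) 1 = 0" "coeff (u mod g) 0 = 0"
      using False by (auto simp: complex_eq_iff)
    then have "u mod g = 0" using r by simp
    then have "g dvd u" by (simp add: mod_eq_0_iff_dvd)
    then show ?thesis using False unfolding g_def by blast
  qed
qed

section \<open>Positive functionals\<close>

text \<open>
  The Cauchy--Schwarz argument in the degenerate case. Only nonnegativity on the line
  through \<open>q\<close> in direction \<open>p\<close> enters, so it applies to functionals that are nonnegative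
  on squares of bounded degree only.
\<close>

lemma psd_null:
  fixes L :: "'n::finite rpoly \<Rightarrow> real"
  assumes L: "linear L" and pos: "\<And>c. 0 \<le> L ((q + c *\<^sub>R p) * (q + c *\<^sub>R p))" and null: "L (p * p) = 0"
  shows "L (p * q) = 0"
proof (rule ccontr)
  assume nz: "L (p * q) \<noteq> 0"
  \<comment> \<open>At this \<open>c\<close> the affine function \<open>L (q\<^sup>2) + 2 c L (p q)\<close> takes the value \<open>- 1\<close>.\<close>
  define c where "c = - (L (q * q) + 1) / (2 * L (p * q))"
  have "(q + c *\<^sub>R p) * (q + c *\<^sub>R p) = q * q + (2 * c) *\<^sub>R (p * q) + (c * c) *\<^sub>R (p * p)"
    by (simp add: algebra_simps scaleR_2 flip: scaleR_scaleR)
  then have "L ((q + c *\<^sub>R p) * (q + c *\<^sub>R p)) = L (q * q) + (2 * c) * L (p * q)"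
    using null by (simp add: linear_add[OF L] linear_scale[OF L])
  also have "\<dots> = - 1"
    using nz by (simp add: c_def field_simps)
  finally show False using pos[of c] by simp
qed

locale positive_functional =
  fixes L :: "'n::finite rpoly \<Rightarrow> real"
  assumes linear: "linear L" and square_nonneg: "0 \<le> L (p * p)"
begin

lemmas L_add = linear_add[OF linear]
  and L_diff = linear_diff[OF linear]
  and L_scaleR = linear_scale[OF linear]
  and L_0 = linear_0[OF linear]

definition null :: "'n rpoly set"
  where "null = {p. L (p * p) = 0}"

lemma null_iff: "p \<in> null \<longleftrightarrow> (\<forall>q. L (p * q) = 0)"
  unfolding null_def using psd_null[OF linear square_nonneg] by blast

lemma null_0 [simp]: "0 \<in> null"
  by (simp add: null_iff L_0)

lemma null_add: "p \<in> null \<Longrightarrow> q \<in> null \<Longrightarrow> p + q \<in> null"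
  by (simp add: null_iff distrib_right L_add)

lemma null_mult: "q \<in> null \<Longrightarrow> p * q \<in> null"
  by (simp add: null_iff mult.commute[of p q] mult.assoc)

lemma null_scaleR: "q \<in> null \<Longrightarrow> c *\<^sub>R q \<in> null"
  by (simp add: null_iff L_scaleR)

text \<open>
  The next two lemmas say that the null ideal is real: they are what excludes multiple roots and
  nonreal roots of the equations satisfied by the variables.
\<close>

lemma null_square_cancel:
  assumes "p * p * k \<in> null"
  shows "p * k \<in> null"
  using assms[unfolded null_iff, rule_format, of k] by (simp add: null_def ac_simps)

lemma null_sum_of_squares_cancel:
  assumes "(p * p + (c * c) *\<^sub>R 1) * k \<in> null" and "c \<noteq> 0"
  shows "k \<in> null"
proof -
  have "(p * p + (c * c) *\<^sub>R 1) * k * k = (p * k) * (p * k) + (c * c) *\<^sub>R (k * k)"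
    by (simp add: algebra_simps)
  then have "L ((p * k) * (p * k)) + (c * c) * L (k * k) = 0"
    using assms(1) by (metis L_add L_scaleR null_iff real_scaleR_def)
  moreover have "0 \<le> (c * c) * L (k * k)"
    using square_nonneg[of k] by simp
  ultimately have "(c * c) * L (k * k) = 0"
    using square_nonneg[of "p * k"] by linarith
  then show ?thesis using assms(2) by (simp add: null_def)
qed

text \<open>
  Split off the factors of \<open>u\<close> one by one: repeated linear factors and quadratic factors without
  real roots can be cancelled, which leaves a product of distinct linear factors. The factor \<open>q\<close>
  carries the parts already split off through the induction.
\<close>

lemma null_real_simple_roots:
  assumes "u \<noteq> 0" "real_poly_at u x * q \<in> null"
  shows "\<exists>A. finite A \<and> (\<Prod>a\<in>A. x - of_real a) * q \<in> null"
  using assms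
proof (induction "degree u" arbitrary: u q rule: less_induct)
  case less
  show ?case
  proof (cases "degree u = 0")
    case True
    then obtain c where c: "u = [:c:]" by (metis degree_eq_zeroE)
    then have "c \<noteq> 0" "c *\<^sub>R q \<in> null"
      using less.prems by (auto simp: of_real_def)
    then have "q \<in> null"
      using null_scaleR[of "c *\<^sub>R q" "1 / c"] by simp
    then show ?thesis by (intro exI[of _ "{}"]) simp
  next
    case False
    then consider a where "[:- a, 1:] dvd u"
      | a b where "b \<noteq> 0" "[:- a, 1:] * [:- a, 1:] + [:b * b:] dvd u"
      using real_poly_factor[of u] by auto
    then show ?thesis
    proof cases
      case 1
      then obtain v where v: "u = [:- a, 1:] * v" by blast
      then have "v \<noteq> 0" "degree v < degree u"
        using less.prems(1) by (auto simp: degree_mult_eq simp del: mult_pCons_left)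
      moreover have "real_poly_at u x * q = real_poly_at v x * ((x - of_real a) * q)"
        unfolding v real_poly_at_mult by (simp add: algebra_simps)
      then have "real_poly_at v x * ((x - of_real a) * q) \<in> null"
        using less.prems(2) by simp
      ultimately obtain A where A: "finite A" "(\<Prod>a\<in>A. x - of_real a) * ((x - of_real a) * q) \<in> null"
        using less.hyps[of v] by blast
      show ?thesis
      proof (cases "a \<in> A")
        case True
        then have "(x - of_real a) * (x - of_real a) * ((\<Prod>a\<in>A - {a}. x - of_real a) * q) \<in> null"
          using A by (simp add: prod.remove[of A a] ac_simps)
        then have "(x - of_real a) * ((\<Prod>a\<in>A - {a}. x - of_real a) * q) \<in> null"
          by (rule null_square_cancel)
        then show ?thesis
          using A True by (intro exI[of _ A]) (simp add: prod.remove[of A a] ac_simps)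
      next
        case False
        then show ?thesis
          using A by (intro exI[of _ "insert a A"]) (simp add: ac_simps)
      qed
    next
      case 2
      define g where "g = [:- a, 1:] * [:- a, 1:] + [:b * b:]"
      have "degree g = 2" by (simp add: g_def)
      from 2 obtain v where v: "u = g * v" unfolding g_def by blast
      then have "v \<noteq> 0" "degree v < degree u"
        using less.prems(1) \<open>degree g = 2\<close> by (auto simp: degree_mult_eq)
      moreover have "real_poly_at v x * (real_poly_at g x * q) \<in> null"
        using less.prems(2) by (simp add: v ac_simps)
      ultimately obtain A where A: "finite A" "(\<Prod>a\<in>A. x - of_real a) * (real_poly_at g x * q) \<in> null"
        using less.hyps[of v] by blast
      have "real_poly_at g x = (x - of_real a) * (x - of_real a) + (b * b) *\<^sub>R 1"
      proof -
        have "real_poly_at [:- a, 1:] x = x - of_real a" by simp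
        moreover have "real_poly_at [:b * b:] x = (b * b) *\<^sub>R 1" by (simp add: of_real_def)
        ultimately show ?thesis
          unfolding g_def real_poly_at_add real_poly_at_mult by simp
      qed
      then have "((x - of_real a) * (x - of_real a) + (b * b) *\<^sub>R 1) * ((\<Prod>a\<in>A. x - of_real a) * q) \<in> null"
        using A(2) by (simp add: ac_simps)
      then show ?thesis
        using null_sum_of_squares_cancel \<open>b \<noteq> 0\<close> A(1) by blast
    qed
  qed
qed

text \<open>
  \<open>q\<close> is a density here: the functional \<open>p \<mapsto> L (p q)\<close> is required to be a combination of point
  evaluations, with weights of any sign.
\<close>

definition atomic :: "'n rpoly \<Rightarrow> bool"
  where "atomic q \<longleftrightarrow>
    (\<exists>G w. finite G \<and> (\<forall>p. L (p * q) = (\<Sum>g\<in>G. w g * poly_eval p g)))"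

lemma atomic_null: "q \<in> null \<Longrightarrow> atomic q"
  unfolding atomic_def by (intro exI[of _ "{}"]) (simp add: null_iff mult.commute)

lemma atomic_add:
  assumes "atomic q" "atomic q'"
  shows "atomic (q + q')"
proof -
  obtain G w where G: "finite G" "\<And>p. L (p * q) = (\<Sum>g\<in>G. w g * poly_eval p g)"
    using assms(1) unfolding atomic_def by blast
  obtain G' w' where G': "finite G'" "\<And>p. L (p * q') = (\<Sum>g\<in>G'. w' g * poly_eval p g)"
    using assms(2) unfolding atomic_def by blast
  let ?v = "\<lambda>g. (if g \<in> G then w g else 0) + (if g \<in> G' then w' g else 0)"
  have "L (p * (q + q')) = (\<Sum>g\<in>G \<union> G'. ?v g * poly_eval p g)" for p
  proof -
    have "(\<Sum>g\<in>G \<union> G'. ?v g * poly_eval p g)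
        = (\<Sum>g\<in>G \<union> G'. if g \<in> G then w g * poly_eval p g else 0)
          + (\<Sum>g\<in>G \<union> G'. if g \<in> G' then w' g * poly_eval p g else 0)"
      by (subst sum.distrib[symmetric]) (auto intro!: sum.cong simp: algebra_simps)
    also have "\<dots> = (\<Sum>g\<in>G. w g * poly_eval p g) + (\<Sum>g\<in>G'. w' g * poly_eval p g)"
      using G(1) G'(1) by (simp add: Int_absorb1 flip: sum.inter_restrict)
    finally show ?thesis
      using G(2) G'(2) by (simp add: distrib_left L_add)
  qed
  then show ?thesis
    unfolding atomic_def using G(1) G'(1) by (intro exI[of _ "G \<union> G'"] exI[of _ ?v]) simp
qed

text \<open>
  Modulo the null ideal, multiplication by \<open>Var i\<close> acts on \<open>q\<close> as the scalar \<open>g $ i\<close>, hence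
  multiplication by \<open>p\<close> acts as \<open>poly_eval p g\<close>.
\<close>

lemma atomic_eigenvector:
  assumes "\<And>i. (Var i - of_real (g $ i)) * q \<in> null"
  shows "atomic q"
proof -
  have "(p - of_real (poly_eval p g)) * q \<in> null" for p
  proof (induction p rule: rpoly_induct)
    case (const c)
    then show ?case by (simp add: of_real_def)
  next
    case (add p p')
    from null_add[OF this] show ?case by (simp add: algebra_simps)
  next
    case (Var_mult i p)
    have "(Var i * p - of_real (poly_eval (Var i * p) g)) * q
        = Var i * ((p - of_real (poly_eval p g)) * q)
          + of_real (poly_eval p g) * ((Var i - of_real (g $ i)) * q)"
      by (simp add: algebra_simps)
    then show ?case
      using null_add[OF null_mult[OF Var_mult] null_mult[OF assms]] by simp
  qed
  then have "L ((p - of_real (poly_eval p g)) * q * 1) = 0" for p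
    unfolding null_iff by blast
  then have "L (p * q) = poly_eval p g * L q" for p
    by (simp add: left_diff_distrib L_diff L_scaleR of_real_def)
  then show ?thesis
    unfolding atomic_def by (intro exI[of _ "{g}"] exI[of _ "\<lambda>_. L q"]) simp
qed

lemma eigenvector_prod:
  assumes "(x - of_real a) * q \<in> null" "finite B"
  shows "(\<Prod>b\<in>B. x - of_real b) * q - (\<Prod>b\<in>B. a - b) *\<^sub>R q \<in> null"
  using assms(2)
proof induction
  case (insert b B)
  let ?P = "\<Prod>b\<in>B. x - of_real b" and ?c = "\<Prod>b\<in>B. a - b"
  have "(\<Prod>b\<in>insert b B. x - of_real b) * q - (\<Prod>b\<in>insert b B. a - b) *\<^sub>R q
      = (a - b) *\<^sub>R (?P * q - ?c *\<^sub>R q) + ?P * ((x - of_real a) * q)"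
    using insert.hyps by (simp add: of_real_def algebra_simps)
  then show ?case
    using null_add[OF null_scaleR[OF insert.IH] null_mult[OF assms(1)]] by simp
qed simp

text \<open>
  If distinct roots annihilate \<open>q\<close>, then \<open>q\<close> is a sum of eigenvectors of \<open>x\<close>, as in Lagrange
  interpolation. All summands are multiples \<open>k * q\<close>, so equations that \<open>q\<close> already satisfies
  for other variables are inherited.
\<close>

lemma atomic_split:
  assumes "finite A" "(\<Prod>a\<in>A. x - of_real a) * q \<in> null"
    and eigen: "\<And>a k. (x - of_real a) * (k * q) \<in> null \<Longrightarrow> atomic (k * q)"
  shows "atomic q"
proof -
  have "atomic (k * q)" if "(\<Prod>a\<in>A. x - of_real a) * (k * q) \<in> null" for k
    using assms(1) that
  proof (induction arbitrary: k)
    case empty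
    then show ?case by (simp add: atomic_null)
  next
    case (insert a A)
    \<comment> \<open>\<open>P * (k * q) / c\<close> is the component of \<open>k * q\<close> at the root \<open>a\<close>; the rest is annihilated by \<open>P\<close>.\<close>
    define P where "P = (\<Prod>b\<in>A. x - of_real b)"
    define c where "c = (\<Prod>b\<in>A. a - b)"
    have "c \<noteq> 0" using insert.hyps by (auto simp: c_def)
    have e: "(x - of_real a) * (P * (k * q)) \<in> null"
      using insert.prems insert.hyps by (simp add: P_def ac_simps)
    have "atomic (((1 / c) *\<^sub>R P * k) * q)"
    proof (rule eigen)
      show "(x - of_real a) * (((1 / c) *\<^sub>R P * k) * q) \<in> null"
        using null_scaleR[OF e, of "1 / c"] by (simp add: ac_simps)
    qed
    moreover have "atomic ((k - (1 / c) *\<^sub>R P * k) * q)"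
    proof (rule insert.IH)
      have eq: "P * ((k - (1 / c) *\<^sub>R P * k) * q) = (- (1 / c)) *\<^sub>R (P * (P * (k * q)) - c *\<^sub>R (P * (k * q)))"
        using \<open>c \<noteq> 0\<close> by (simp add: algebra_simps)
      show "(\<Prod>b\<in>A. x - of_real b) * ((k - (1 / c) *\<^sub>R P * k) * q) \<in> null"
        unfolding P_def[symmetric] eq
        using null_scaleR[OF eigenvector_prod[OF e insert.hyps(1)], of "- (1 / c)"]
        unfolding P_def[symmetric] c_def[symmetric] .
    qed
    ultimately show ?case
      using atomic_add by (fastforce simp: algebra_simps)
  qed
  from this[of 1] show ?thesis using assms(2) by simp
qed

text \<open>
  The variables are diagonalised one at a time; \<open>S\<close> is the set of variables still to be treated.
  The points found for different components may coincide, so the signs of the weights are only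
  visible after all components have been collected, by testing on squares of interpolation
  polynomials.
\<close>

theorem atomic_representation:
  assumes algebraic: "\<And>i. \<exists>u. u \<noteq> 0 \<and> real_poly_at u (Var i) \<in> null"
  obtains G w where "finite G" "\<And>g. g \<in> G \<Longrightarrow> 0 < w g" "\<And>p. L p = (\<Sum>g\<in>G. w g * poly_eval p g)"
proof -
  have "atomic q" if "finite S" "\<And>i. i \<notin> S \<Longrightarrow> (Var i - of_real (g $ i)) * q \<in> null" for S q and g :: "real ^ 'n"
    using that
  proof (induction S arbitrary: q g)
    case empty
    then show ?case by (intro atomic_eigenvector) simp
  next
    case (insert j S)
    obtain u where "u \<noteq> 0" "real_poly_at u (Var j) * 1 \<in> null"
      using algebraic[of j] by auto
    from null_real_simple_roots[OF this]
    obtain A where A: "finite A" "(\<Prod>a\<in>A. Var j - of_real a) * 1 \<in> null"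
      by blast
    show ?case
    proof (rule atomic_split[OF A(1)])
      show "(\<Prod>a\<in>A. Var j - of_real a) * q \<in> null"
        using null_mult[OF A(2), of q] by (simp add: mult.commute)
    next
      fix a k
      assume a: "(Var j - of_real a) * (k * q) \<in> null"
      let ?g = "(\<chi> i. if i = j then a else g $ i) :: real ^ 'n"
      show "atomic (k * q)"
      proof (rule insert.IH)
        fix i assume "i \<notin> S"
        show "(Var i - of_real (?g $ i)) * (k * q) \<in> null"
        proof (cases "i = j")
          case False
          then show ?thesis
            using null_mult[OF insert.prems[of i], of k] \<open>i \<notin> S\<close> by (simp add: mult.left_commute)
        qed (use a in simp)
      qed
    qed
  qed
  from this[of UNIV 1] have "atomic 1"
    by simp
  then obtain G w where G: "finite G" "\<And>p. L p = (\<Sum>g\<in>G. w g * poly_eval p g)"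
    unfolding atomic_def by auto
  have nonneg: "0 \<le> w g" if "g \<in> G" for g
  proof -
    obtain e where e: "\<And>g'. g' \<in> G \<Longrightarrow> poly_eval e g' = (if g' = g then 1 else 0)"
      using interpolation_polynomial[OF G(1)] by blast
    have "L (e * e) = (\<Sum>g'\<in>G. if g' = g then w g' else 0)"
      using G(2)[of "e * e"] e by (auto intro!: sum.cong)
    then show ?thesis
      using square_nonneg[of e] G(1) that by simp
  qed
  show thesis
  proof (rule that[of "{g\<in>G. w g \<noteq> 0}" w])
    show "L p = (\<Sum>g | g \<in> G \<and> w g \<noteq> 0. w g * poly_eval p g)" for p
      using G by (auto intro!: sum.mono_neutral_right)
  qed (use G(1) nonneg in \<open>auto simp: less_le\<close>)
qed

end

section \<open>Extending a flat functional to all polynomials\<close>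

lemma Var_mult_in_polys_upto:
  assumes "p \<in> polys_upto k"
  shows "Var i * p \<in> polys_upto (Suc k)"
  using mult_in_polys_upto[of "Var i" 1 p k] assms monom_in_polys_upto[of "Poly_Mapping.single i (Suc 0)" 1]
  by (simp add: mexps_def)

text \<open>
  \<open>N\<close> chooses, linearly, representatives of degree at most \<open>k\<close> for polynomials of degree
  at most \<open>k + 1\<close> modulo the kernel of the form \<open>L (p q)\<close>. A genuine choice of representatives, instead
  of classes, turns identities modulo the kernel into equations. Apart from linearity, the
  conditions concern \<open>L\<close> in degrees up to \<open>2 (k + 1)\<close> only.
\<close>

locale flat_functional =
  fixes L :: "'n::finite rpoly \<Rightarrow> real" and k :: nat and N :: "'n rpoly \<Rightarrow> 'n rpoly"
  assumes linear: "linear L"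
    and pos: "p \<in> polys_upto (Suc k) \<Longrightarrow> 0 \<le> L (p * p)"
    and linear_N: "linear N"
    and N_range: "N p \<in> polys_upto k"
    and N_reduces: "p \<in> polys_upto (Suc k) \<Longrightarrow> r \<in> polys_upto (Suc k) \<Longrightarrow> L (r * N p) = L (r * p)"
    and N_kernel: "p \<in> polys_upto (Suc k) \<Longrightarrow> (\<And>r. r \<in> polys_upto (Suc k) \<Longrightarrow> L (r * p) = 0) \<Longrightarrow> N p = 0"
begin

lemmas L_diff = linear_diff[OF linear]

lemma lower: "p \<in> polys_upto k \<Longrightarrow> p \<in> polys_upto (Suc k)"
  using polys_upto_mono[of k "Suc k"] by auto

lemma N_upto: "N p \<in> polys_upto (Suc k)"
  by (rule lower[OF N_range])

text \<open>
  Since every test polynomial may itself be reduced, it suffices to test with polynomials of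
  degree at most \<open>k\<close>. This leaves room to multiply the test polynomial by a variable.
\<close>

lemma N_cong:
  assumes "p \<in> polys_upto (Suc k)" "q \<in> polys_upto (Suc k)"
    and "\<And>r. r \<in> polys_upto k \<Longrightarrow> L (r * p) = L (r * q)"
  shows "N p = N q"
proof -
  have "N (p - q) = 0"
  proof (rule N_kernel)
    show pq: "p - q \<in> polys_upto (Suc k)"
      using assms by (simp add: subspace_diff)
    fix r :: "'n rpoly" assume r: "r \<in> polys_upto (Suc k)"
    have "L (r * (p - q)) = L (N r * (p - q))"
      using N_reduces[OF r pq] by (simp add: mult.commute)
    then show "L (r * (p - q)) = 0"
      using assms(3)[OF N_range, of r] by (simp add: right_diff_distrib L_diff)
  qed
  then show ?thesis by (simp add: linear_diff[OF linear_N])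
qed

text \<open>Multiplication by a variable, followed by reduction.\<close>

definition X :: "'n \<Rightarrow> 'n rpoly \<Rightarrow> 'n rpoly"
  where "X i p = N (Var i * p)"

lemma linear_X: "linear (X i)"
  by (rule linearI)
    (simp_all add: X_def distrib_left linear_add[OF linear_N] linear_scale[OF linear_N])

lemma X_range: "X i p \<in> polys_upto k"
  by (simp add: X_def N_range)

lemmas Var_upto = Var_mult_in_polys_upto

lemma X_selfadjoint:
  assumes "p \<in> polys_upto k" "q \<in> polys_upto (Suc k)"
  shows "L (q * X i p) = L (Var i * q * p)"
  unfolding X_def using N_reduces[OF Var_upto[OF assms(1)] assms(2)] by (simp add: ac_simps)

text \<open>
  Both sides have the same products with every test polynomial \<open>r\<close>, because the two variables can be
  moved to \<open>r\<close> in either order.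
\<close>

lemma X_commute:
  assumes p: "p \<in> polys_upto k"
  shows "X i (X j p) = X j (X i p)"
proof -
  have "L (r * (Var i * X j p)) = L (Var i * Var j * r * p)" if "r \<in> polys_upto k" for r i j
    using X_selfadjoint[OF p Var_upto[OF that, of i]] by (simp add: ac_simps)
  then show ?thesis
    unfolding X_def[of i "X j p"] X_def[of j "X i p"]
    by (intro N_cong Var_upto X_range) (simp add: mult.commute[of "Var i" "Var j"])
qed

text \<open>
  The normal form of \<open>x\<^sup>\<alpha>\<close> applies the operators \<open>X i\<close> to the normal form of \<open>1\<close>. The order is left to
  an arbitrary choice at each step; by commutation, \<open>nf_add\<close> holds for any variable.
\<close>

function nf :: "'n mexp \<Rightarrow> 'n rpoly"
  where "nf \<alpha> = (if \<alpha> = 0 then N 1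
      else let i = (SOME i. Poly_Mapping.lookup \<alpha> i \<noteq> 0) in X i (nf (\<alpha> - Poly_Mapping.single i (Suc 0))))"
  by auto

lemma some_key: "\<alpha> \<noteq> 0 \<Longrightarrow> Poly_Mapping.lookup \<alpha> (SOME i. Poly_Mapping.lookup \<alpha> i \<noteq> 0) \<noteq> 0"
  for \<alpha> :: "'n mexp"
  by (rule someI_ex) (metis lookup_zero poly_mapping_eqI)

termination
proof (relation "Wellfounded.measure mdeg")
  fix \<alpha> :: "'n mexp" and i
  assume "\<alpha> \<noteq> 0" "i = (SOME i. Poly_Mapping.lookup \<alpha> i \<noteq> 0)"
  then have "Poly_Mapping.lookup \<alpha> i \<noteq> 0"
    using some_key by blast
  then show "(\<alpha> - Poly_Mapping.single i (Suc 0), \<alpha>) \<in> Wellfounded.measure mdeg"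
    using arg_cong[OF mexp_diff_single, of \<alpha> i mdeg] by (simp add: mdeg_add)
qed simp

declare nf.simps [simp del]

lemma nf_zero: "nf 0 = N 1"
  by (simp add: nf.simps)

lemma nf_range: "nf \<alpha> \<in> polys_upto k"
  by (subst nf.simps) (simp add: N_range X_range Let_def)

lemma nf_add: "nf (\<alpha> + Poly_Mapping.single i (Suc 0)) = X i (nf \<alpha>)"
proof (induction "mdeg \<alpha>" arbitrary: \<alpha> i rule: less_induct)
  case less
  let ?e = "\<lambda>i. Poly_Mapping.single i (Suc 0)"
  define \<gamma> where "\<gamma> = \<alpha> + ?e i"
  define j where "j = (SOME j. Poly_Mapping.lookup \<gamma> j \<noteq> 0)"
  have "mdeg \<gamma> \<noteq> 0" by (simp add: \<gamma>_def mdeg_add)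
  then have "\<gamma> \<noteq> 0" by auto
  then have nf: "nf \<gamma> = X j (nf (\<gamma> - ?e j))" and j: "Poly_Mapping.lookup \<gamma> j \<noteq> 0"
    using some_key[of \<gamma>] by (simp_all add: nf.simps[of \<gamma>] j_def Let_def)
  show ?case
  proof (cases "j = i")
    case True
    then show ?thesis using nf by (simp add: \<gamma>_def)
  next
    case False
    define \<beta> where "\<beta> = \<alpha> - ?e j"
    have \<alpha>: "\<alpha> = \<beta> + ?e j"
      using j False mexp_diff_single[of \<alpha> j] by (auto simp: \<gamma>_def \<beta>_def lookup_add lookup_single when_def)
    then have "\<gamma> = \<beta> + ?e i + ?e j"
      by (simp add: \<gamma>_def ac_simps)
    then have \<gamma>: "\<gamma> - ?e j = \<beta> + ?e i"
      by simp
    have "mdeg \<beta> < mdeg \<alpha>" by (simp add: \<alpha> mdeg_add)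
    note IH = less[OF this]
    have "nf \<gamma> = X j (X i (nf \<beta>))" by (simp add: nf \<gamma> IH)
    also have "\<dots> = X i (X j (nf \<beta>))" by (rule X_commute[OF nf_range])
    also have "\<dots> = X i (nf \<alpha>)" by (simp only: IH[symmetric] \<alpha>[symmetric])
    finally show ?thesis by (simp add: \<gamma>_def)
  qed
qed

definition NF :: "'n rpoly \<Rightarrow> 'n rpoly"
  where "NF = lin_ext nf"

lemma linear_NF: "linear NF"
  unfolding NF_def by (rule linear_lin_ext)

lemma NF_range: "NF p \<in> polys_upto k"
  unfolding NF_def lin_ext_def by (intro subspace_sum subspace_scale nf_range subspace_polys_upto)

lemma NF_upto: "NF p \<in> polys_upto (Suc k)"
  by (rule lower[OF NF_range])

lemma NF_Var_mult: "NF (Var i * p) = X i (NF p)"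
proof (rule linear_eq_on_monom[of "\<lambda>p. NF (Var i * p)" "\<lambda>p. X i (NF p)"])
  show "linear (\<lambda>p. NF (Var i * p))"
    using linear_compose[OF linear_mult_left linear_NF] by (simp add: o_def)
  show "linear (\<lambda>p. X i (NF p))"
    using linear_compose[OF linear_NF linear_X] by (simp add: o_def)
  show "NF (Var i * monomial \<alpha>) = X i (NF (monomial \<alpha>))" for \<alpha>
  proof -
    have "Var i * monomial \<alpha> = monomial (\<alpha> + Poly_Mapping.single i (Suc 0))"
      by (simp add: monom_add mult.commute)
    then show ?thesis by (simp add: NF_def nf_add)
  qed
qed

lemma NF_eq_N:
  assumes "p \<in> polys_upto (Suc k)"
  shows "NF p = N p"
proof (rule linear_eq_on_polys_upto[OF linear_NF linear_N _ assms])
  fix \<alpha> :: "'n mexp" assume "\<alpha> \<in> mexps (Suc k)"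
  then show "NF (monomial \<alpha>) = N (monomial \<alpha>)"
  proof (induction \<alpha> rule: mexp_induct)
    case zero
    show ?case unfolding NF_def lin_ext_single nf_zero by simp
  next
    case (add \<beta> i)
    then have \<beta>: "\<beta> \<in> mexps k" "\<beta> \<in> mexps (Suc k)" by (auto simp: mexps_def mdeg_add)
    have "NF (monomial (\<beta> + Poly_Mapping.single i (Suc 0))) = X i (N (monomial \<beta>))"
      by (simp add: monom_add mult.commute[of _ "Var i"] NF_Var_mult add.IH[OF \<beta>(2)])
    also have "\<dots> = N (Var i * monomial \<beta>)"
      unfolding X_def
    proof (rule N_cong)
      fix r :: "'n rpoly" assume "r \<in> polys_upto k"
      then show "L (r * (Var i * N (monomial \<beta>))) = L (r * (Var i * monomial \<beta>))"
        using N_reduces[OF monom_in_polys_upto[OF \<beta>(2)] Var_upto[of r k i]] by (simp add: ac_simps)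
    qed (intro Var_upto N_range monom_in_polys_upto \<beta>(1))+
    finally show ?case by (simp add: monom_add mult.commute)
  qed
qed

text \<open>
  This identity is why \<open>p \<mapsto> L (NF p)\<close> is nonnegative on squares: it gives
  \<open>L (NF (p * q)) = L (NF p * NF q)\<close>.
\<close>

lemma NF_selfadjoint: "L (NF (r * p) * NF q) = L (NF p * NF (r * q))"
proof (induction r arbitrary: p q rule: rpoly_induct)
  case (const c)
  then show ?case by (simp add: linear_scale[OF linear_NF])
next
  case (add r r')
  then show ?case by (simp add: distrib_left distrib_right linear_add[OF linear_NF] linear_add[OF linear])
next
  case (Var_mult i r)
  have "L (NF (Var i * (r * p)) * NF q) = L (NF q * X i (NF (r * p)))"
    unfolding NF_Var_mult by (simp only: mult.commute)
  also have "\<dots> = L (Var i * NF q * NF (r * p))"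
    by (rule X_selfadjoint[OF NF_range NF_upto])
  also have "\<dots> = L (Var i * NF (r * p) * NF q)"
    by (simp add: ac_simps)
  also have "\<dots> = L (NF (r * p) * X i (NF q))"
    by (rule X_selfadjoint[OF NF_range NF_upto, symmetric])
  also have "\<dots> = L (NF p * NF (r * (Var i * q)))"
    by (simp add: Var_mult flip: NF_Var_mult)
  finally show ?case by (simp add: ac_simps)
qed

lemma NF_mult: "L (NF (p * q)) = L (NF p * NF q)"
proof -
  have "L (NF (p * q)) = L (NF (p * q) * NF 1)"
    using N_reduces[of 1 "NF (p * q)"] NF_upto by (simp add: NF_eq_N)
  also have "\<dots> = L (NF q * NF p)"
    using NF_selfadjoint[of p q 1] by simp
  finally show ?thesis by (simp add: mult.commute)
qed

lemma NF_extends: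
  assumes "p \<in> polys_upto (2 * Suc k)"
  shows "L (NF p) = L p"
proof (rule linear_eq_on_polys_upto[OF _ linear _ assms])
  show "linear (\<lambda>p. L (NF p))"
    using linear_compose[OF linear_NF linear] by (simp add: o_def)
  fix \<gamma> :: "'n mexp" assume "\<gamma> \<in> mexps (2 * Suc k)"
  then obtain \<alpha> \<beta> where g: "\<alpha> \<in> mexps (Suc k)" "\<beta> \<in> mexps (Suc k)" "\<gamma> = \<alpha> + \<beta>"
    using mexps_add_split[of \<gamma> "Suc k" "Suc k"] by (metis mult_2)
  note up = g(1,2)[THEN monom_in_polys_upto]
  have "L (NF (monomial \<gamma>)) = L (N (monomial \<alpha>) * N (monomial \<beta>))"
    using up by (simp add: g(3) monom_add NF_mult NF_eq_N)
  also have "\<dots> = L (monomial \<alpha> * monomial \<beta>)"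
    using N_reduces[OF up(2) N_upto] N_reduces[OF up(1,2)] by (simp add: mult.commute)
  finally show "L (NF (monomial \<gamma>)) = L (monomial \<gamma>)" by (simp add: g(3) monom_add)
qed

text \<open>The powers of \<open>x\<close> have normal forms in a space of finite dimension, so they are dependent.\<close>

lemma NF_algebraic: "\<exists>u. u \<noteq> 0 \<and> NF (real_poly_at u x) = 0"
proof -
  let ?B = "monomial ` mexps k :: 'n rpoly set"
  let ?v = "\<lambda>k. NF (x ^ k)"
  let ?S = "?v ` {..card ?B}"
  have NF_at: "NF (real_poly_at (\<Sum>k\<in>K. Polynomial.monom (c k) k) x) = (\<Sum>k\<in>K. c k *\<^sub>R ?v k)"
    for c and K :: "nat set"
    by (simp add: real_poly_at_sum real_poly_at_monom linear_sum[OF linear_NF] linear_scale[OF linear_NF])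
  show ?thesis
  proof (cases "inj_on ?v {..card ?B}")
    case True
    then have "card ?S > card ?B" by (simp add: card_image)
    moreover have "?S \<subseteq> span ?B"
      using NF_range by (auto simp flip: polys_upto_span)
    ultimately have "dependent ?S"
      using independent_span_bound[OF finite_monoms, of ?S] by force
    then obtain c v where c: "v \<in> ?S" "c v \<noteq> 0" "(\<Sum>v\<in>?S. c v *\<^sub>R v) = 0"
      by (auto simp: dependent_finite)
    let ?u = "\<Sum>k\<le>card ?B. Polynomial.monom (c (?v k)) k"
    obtain k where k: "k \<le> card ?B" "v = ?v k" using c(1) by auto
    have "coeff ?u k = c v"
      using k by (simp add: coeff_sum sum.delta cong: if_cong)
    then have "?u \<noteq> 0" using c(2) by (metis coeff_0)
    moreover have "NF (real_poly_at ?u x) = 0"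
      using c(3) unfolding NF_at sum.reindex[OF True] o_def .
    ultimately show ?thesis by blast
  next
    case False
    then obtain k l where kl: "k \<noteq> l" "?v k = ?v l" by (auto simp: inj_on_def)
    let ?u = "Polynomial.monom (1::real) k + Polynomial.monom (- 1) l"
    have "coeff ?u k = 1" using kl(1) by simp
    then have "?u \<noteq> 0" by (metis coeff_0 zero_neq_one)
    moreover have "NF (real_poly_at ?u x) = 0"
      using kl(2) by (simp add: real_poly_at_monom linear_diff[OF linear_NF])
    ultimately show ?thesis by blast
  qed
qed

theorem flat_atomic:
  obtains G w where "finite G" "\<And>g. g \<in> G \<Longrightarrow> 0 < w g"
    "\<And>p. p \<in> polys_upto (2 * Suc k) \<Longrightarrow> L p = (\<Sum>g\<in>G. w g * poly_eval p g)"
proof -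
  interpret ext: positive_functional "\<lambda>p. L (NF p)"
  proof (rule positive_functional.intro)
    show "linear (\<lambda>p. L (NF p))"
      using linear_compose[OF linear_NF linear] by (simp add: o_def)
    show "0 \<le> L (NF (p * p))" for p
      unfolding NF_mult by (rule pos[OF NF_upto])
  qed
  have "\<exists>u. u \<noteq> 0 \<and> real_poly_at u (Var i) \<in> ext.null" for i
    using NF_algebraic[of "Var i"] unfolding ext.null_def by (auto simp: NF_mult linear_0[OF linear])
  from ext.atomic_representation[OF this] obtain G w where
    "finite G" "\<And>g. g \<in> G \<Longrightarrow> 0 < w g" "\<And>p. L (NF p) = (\<Sum>g\<in>G. w g * poly_eval p g)"
    by blast
  then show thesis using that[of G w] NF_extends by simp
qed

end

section \<open>Moment matrices\<close>

text \<open>The functional that sends each monomial to its moment.\<close>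

abbreviation riesz :: "('n mexp \<Rightarrow> real) \<Rightarrow> 'n rpoly \<Rightarrow> real"
  where "riesz y \<equiv> lin_ext y"

lemmas linear_riesz = linear_lin_ext[where 'b = real]

lemma linear_riesz_mult: "linear (\<lambda>p::'n::finite rpoly. riesz y (q * p))"
  using linear_compose[OF linear_mult_left linear_riesz] by (simp add: o_def)

lemma linear_riesz_mult': "linear (\<lambda>p::'n::finite rpoly. riesz y (p * q))"
  using linear_compose[OF linear_mult_right linear_riesz] by (simp add: o_def)

lemma riesz_cong:
  assumes "\<And>\<alpha>. \<alpha> \<in> mexps s \<Longrightarrow> y \<alpha> = z \<alpha>" "p \<in> polys_upto s"
  shows "riesz y p = riesz z p"
  by (rule linear_eq_on_polys_upto[OF linear_riesz linear_riesz _ assms(2)]) (simp add: assms(1))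

lemma riesz_monom_mult:
  fixes p :: "'n::finite rpoly"
  shows "riesz y (monomial \<alpha> * p) = lin_ext (\<lambda>\<beta>. y (\<alpha> + \<beta>)) p"
  by (rule linear_eq_on_monom[OF linear_riesz_mult linear_lin_ext]) (simp flip: monom_add)

lemma shift_seq_eq_riesz: "shift_seq h y \<alpha> = riesz y (monomial \<alpha> * h)" for h :: "'n::finite rpoly"
  unfolding riesz_monom_mult by (simp add: shift_seq_def lin_ext_def)

lemma riesz_mult_zero_iff:
  fixes p :: "'n::finite rpoly"
  shows "(\<forall>\<alpha>\<in>mexps s. riesz y (monomial \<alpha> * p) = 0) \<longleftrightarrow> (\<forall>r\<in>polys_upto s. riesz y (r * p) = 0)"
proof
  assume *: "\<forall>\<alpha>\<in>mexps s. riesz y (monomial \<alpha> * p) = 0"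
  have "linear (\<lambda>p::'n rpoly. 0 :: real)" by (rule linearI) auto
  then show "\<forall>r\<in>polys_upto s. riesz y (r * p) = 0"
    using linear_eq_on_polys_upto[OF linear_riesz_mult', of "\<lambda>_. 0" s y p] * by blast
qed (simp add: monom_in_polys_upto)

lemma moment_kernel_eq:
  "moment_kernel s y = {p \<in> polys_upto s. \<forall>r\<in>polys_upto s. riesz y (r * p) = 0}"
proof -
  have "(\<Sum>\<beta>\<in>mexps s. moment_entry y \<alpha> \<beta> * Poly_Mapping.lookup p \<beta>) = riesz y (monomial \<alpha> * p)"
    if "Poly_Mapping.keys p \<subseteq> mexps s" for p :: "'a rpoly" and \<alpha>
    unfolding riesz_monom_mult lin_ext_superset[OF finite_mexps that]
    by (simp add: moment_entry_def mult.commute)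
  then have "moment_kernel s y = {p \<in> polys_upto s. \<forall>\<alpha>\<in>mexps s. riesz y (monomial \<alpha> * p) = 0}"
    unfolding moment_kernel_def kernel_on_def polys_upto_def by auto
  then show ?thesis
    unfolding riesz_mult_zero_iff .
qed

lemma psd_on_moment_entry:
  fixes y :: "'n::finite mexp \<Rightarrow> real"
  shows "psd_on (mexps s) (moment_entry y) \<longleftrightarrow> (\<forall>p\<in>polys_upto s. 0 \<le> riesz y (p * p))"
proof -
  define S where "S c = (\<Sum>a\<in>mexps s. c a *\<^sub>R monomial a)" for c :: "'n mexp \<Rightarrow> real"
  have quadratic: "(\<Sum>a\<in>mexps s. \<Sum>b\<in>mexps s. c a * moment_entry y a b * c b) = riesz y (S c * S c)" for c
  proof -
    have "riesz y ((c a *\<^sub>R monomial a) * (c b *\<^sub>R monomial b)) = c a * moment_entry y a b * c b" for a b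
      by (simp add: mult_single moment_entry_def linear_scale[OF linear_riesz])
    then show ?thesis
      by (simp only: S_def sum_product linear_sum[OF linear_riesz])
  qed
  have S_lookup: "S (Poly_Mapping.lookup p) = p" if "p \<in> polys_upto s" for p
  proof -
    have "lin_ext monomial p = S (Poly_Mapping.lookup p)"
      unfolding S_def using that by (intro lin_ext_superset finite_mexps) (simp add: polys_upto_def)
    then show ?thesis
      using monom_expansion[of p] unfolding lin_ext_def by simp
  qed
  have S_upto: "S c \<in> polys_upto s" for c
    unfolding S_def by (intro subspace_sum subspace_scale subspace_polys_upto monom_in_polys_upto)
  show ?thesis
    unfolding psd_on_def quadratic
  proof safe
    fix p :: "'n rpoly"
    assume "p \<in> polys_upto s" and *: "\<forall>c. 0 \<le> riesz y (S c * S c)"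
    then show "0 \<le> riesz y (p * p)"
      using *[rule_format, of "Poly_Mapping.lookup p"] by (simp only: S_lookup)
  qed (use S_upto in \<open>auto simp: moment_entry_def add.commute\<close>)
qed

lemma zero_on_localizing:
  fixes h :: "'n::finite rpoly"
  shows "zero_on (mexps k) (moment_entry (shift_seq h y)) \<longleftrightarrow> (\<forall>p\<in>polys_upto (2 * k). riesz y (p * h) = 0)"
proof -
  have "zero_on (mexps k) (moment_entry (shift_seq h y)) \<longleftrightarrow> (\<forall>\<alpha>\<in>mexps (2 * k). riesz y (monomial \<alpha> * h) = 0)"
    unfolding zero_on_def moment_entry_def shift_seq_eq_riesz
  proof safe
    fix \<gamma> :: "'n mexp"
    assume *: "\<forall>a\<in>mexps k. \<forall>b\<in>mexps k. riesz y (monomial (a + b) * h) = 0" "\<gamma> \<in> mexps (2 * k)"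
    then show "riesz y (monomial \<gamma> * h) = 0"
      using mexps_add_split[of \<gamma> k k] by (metis mult_2)
  qed (use mexps_add[of _ k _ k] in \<open>auto simp: mult_2\<close>)
  then show ?thesis unfolding riesz_mult_zero_iff .
qed

text \<open>
  Multiplication by \<open>M\<^sub>s(y)\<close>, but defined on polynomials of any degree; restricting it to lower degrees
  allows moment matrices of different orders to be compared in a common target space.
\<close>

definition moment_map :: "nat \<Rightarrow> ('n::finite mexp \<Rightarrow> real) \<Rightarrow> 'n rpoly \<Rightarrow> 'n rpoly"
  where "moment_map s y p = (\<Sum>\<alpha>\<in>mexps s. Poly_Mapping.single \<alpha> (riesz y (monomial \<alpha> * p)))"

lemma lookup_moment_map:
  "Poly_Mapping.lookup (moment_map s y p) \<alpha> = (if \<alpha> \<in> mexps s then riesz y (monomial \<alpha> * p) else 0)"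
  by (simp add: moment_map_def lookup_sum lookup_single when_def finite_mexps)

lemma linear_moment_map: "linear (moment_map s y)"
  by (rule linearI; rule poly_mapping_eqI)
    (simp_all add: lookup_moment_map lookup_add distrib_left linear_add[OF linear_riesz] linear_scale[OF linear_riesz])

lemma moment_map_eq_0_iff: "moment_map s y p = 0 \<longleftrightarrow> (\<forall>r\<in>polys_upto s. riesz y (r * p) = 0)"
  unfolding riesz_mult_zero_iff[symmetric] by (auto simp: poly_mapping_eq_iff fun_eq_iff lookup_moment_map)

lemma moment_rank_eq_dim: "moment_rank s y = dim (moment_map s y ` polys_upto s)"
proof -
  have "column_on (mexps s) (moment_entry y) \<beta> = moment_map s y (monomial \<beta>)" for \<beta>
    by (simp add: column_on_def moment_map_def moment_entry_def flip: monom_add)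
  then have "moment_rank s y = dim (moment_map s y ` monomial ` mexps s)"
    by (simp add: moment_rank_def rank_on_def image_image)
  then show ?thesis
    by (simp add: polys_upto_span flip: linear_span_image[OF linear_moment_map])
qed

lemma moment_map_rank_nullity:
  fixes y :: "'n::finite mexp \<Rightarrow> real"
  shows "dim (moment_map s y ` polys_upto a) + dim {p \<in> polys_upto a. moment_map s y p = 0}
    = dim (polys_upto a :: 'n rpoly set)"
  by (rule rank_nullity[OF subspace_polys_upto finite_monoms polys_upto_subset_span linear_moment_map])

lemma rank_plus_kernel:
  fixes y :: "'n::finite mexp \<Rightarrow> real"
  shows "moment_rank s y + dim (moment_kernel s y) = dim (polys_upto s :: 'n rpoly set)"
  using moment_map_rank_nullity[of s y s]
  by (simp add: moment_rank_eq_dim moment_kernel_eq moment_map_eq_0_iff)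

definition psd_upto :: "nat \<Rightarrow> ('n::finite mexp \<Rightarrow> real) \<Rightarrow> bool"
  where "psd_upto s y \<longleftrightarrow> (\<forall>p\<in>polys_upto s. 0 \<le> riesz y (p * p))"

lemma psd_upto_mono: "psd_upto t y \<Longrightarrow> s \<le> t \<Longrightarrow> psd_upto s y"
  using polys_upto_mono unfolding psd_upto_def by blast

lemma moment_kernelI_psd:
  assumes "psd_upto s y" "p \<in> polys_upto s" "riesz y (p * p) = 0"
  shows "p \<in> moment_kernel s y"
proof -
  have "riesz y (p * r) = 0" if "r \<in> polys_upto s" for r
  proof (rule psd_null[OF linear_riesz])
    show "0 \<le> riesz y ((r + c *\<^sub>R p) * (r + c *\<^sub>R p))" for c
      using assms(1,2) that subspace_add[OF subspace_polys_upto] subspace_scale[OF subspace_polys_upto]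
      unfolding psd_upto_def by blast
  qed (rule assms(3))
  then show ?thesis using assms(2) by (simp add: moment_kernel_eq mult.commute)
qed

text \<open>
  For positive semidefinite matrices, membership in the kernel is the condition \<open>L (p\<^sup>2) = 0\<close>, which does
  not depend on the order of the matrix.
\<close>

lemma moment_kernel_restrict:
  assumes "psd_upto s y" "a \<le> s"
  shows "{p \<in> polys_upto a. moment_map s y p = 0} = moment_kernel a y"
proof
  show "moment_kernel a y \<subseteq> {p \<in> polys_upto a. moment_map s y p = 0}"
  proof
    fix p assume p: "p \<in> moment_kernel a y"
    then have "p \<in> moment_kernel s y"
      using assms polys_upto_mono[OF assms(2)] by (intro moment_kernelI_psd) (auto simp: moment_kernel_eq)
    then show "p \<in> {p \<in> polys_upto a. moment_map s y p = 0}"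
      using p by (simp add: moment_kernel_eq moment_map_eq_0_iff)
  qed
qed (use polys_upto_mono[OF assms(2)] in \<open>auto simp: moment_kernel_eq moment_map_eq_0_iff\<close>)

lemma moment_kernel_mono:
  assumes "psd_upto s y" "a \<le> s"
  shows "moment_kernel a y \<subseteq> moment_kernel s y"
  using moment_kernel_restrict[OF assms] polys_upto_mono[OF assms(2)]
  by (auto simp: moment_kernel_eq moment_map_eq_0_iff)

lemma dim_moment_map_image:
  assumes "psd_upto s y" "a \<le> s"
  shows "dim (moment_map s y ` polys_upto a) = moment_rank a y"
  using moment_map_rank_nullity[of s y a] rank_plus_kernel[of a y] moment_kernel_restrict[OF assms] by simp

lemma moment_map_image_span: "moment_map s y ` polys_upto a \<subseteq> span (moment_map s y ` monomial ` mexps a)"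
  by (simp add: polys_upto_span flip: linear_span_image[OF linear_moment_map])

lemma moment_rank_mono:
  assumes "psd_upto s y" "a \<le> s"
  shows "moment_rank a y \<le> moment_rank s y"
  unfolding dim_moment_map_image[OF assms, symmetric] moment_rank_eq_dim[of s]
  by (rule dim_mono_finite[OF image_mono[OF polys_upto_mono[OF assms(2)]] _ moment_map_image_span])
    (simp add: finite_mexps)

text \<open>
  Equal ranks mean that the columns of degree at most \<open>a\<close> already span the column space, so every
  polynomial can be reduced modulo the kernel to degree at most \<open>a\<close>.
\<close>

lemma flat_reduction:
  assumes "psd_upto s y" "a \<le> s" "moment_rank s y = moment_rank a y"
  shows "moment_map s y ` polys_upto a = moment_map s y ` polys_upto s"
  by (rule subspace_eqI_dim[OF _ _ image_mono[OF polys_upto_mono[OF assms(2)]] _ moment_map_image_span])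
    (use assms in \<open>simp_all add: finite_mexps dim_moment_map_image linear_subspace_image[OF linear_moment_map]\<close>)

lemma flat_reduction_kernel:
  assumes "psd_upto s y" "a \<le> s" "moment_rank s y = moment_rank a y" "p \<in> polys_upto s"
  obtains q where "q \<in> polys_upto a" "p - q \<in> moment_kernel s y"
proof -
  have "moment_map s y p \<in> moment_map s y ` polys_upto a"
    using flat_reduction[OF assms(1-3)] assms(4) by simp
  then obtain q where q: "q \<in> polys_upto a" "moment_map s y p = moment_map s y q" by blast
  then have "moment_map s y (p - q) = 0"
    by (simp add: linear_diff[OF linear_moment_map])
  moreover have "p - q \<in> polys_upto s"
    using q(1) assms(4) polys_upto_mono[OF assms(2)] by (auto intro: subspace_diff)
  ultimately show thesis
    using that q(1) by (simp add: moment_kernel_eq moment_map_eq_0_iff)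
qed

lemma flat_normal_form:
  assumes psd: "psd_upto (Suc k) y" and flat: "moment_rank (Suc k) y = moment_rank k y"
  obtains N where "flat_functional (riesz y) k N"
proof -
  let ?F = "moment_map (Suc k) y"
  obtain G where G: "range G \<subseteq> polys_upto k" "linear G" "\<And>v. v \<in> ?F ` polys_upto k \<Longrightarrow> ?F (G v) = v"
    using linear_exists_right_inverse_on[OF linear_moment_map[of "Suc k" y] subspace_polys_upto] by blast
  have "flat_functional (riesz y) k (\<lambda>p. G (?F p))"
  proof (rule flat_functional.intro)
    show "linear (\<lambda>p. G (?F p))"
      using linear_compose[OF linear_moment_map G(2)] by (simp add: o_def)
    fix p :: "'a rpoly"
    show "G (?F p) \<in> polys_upto k" using G(1) by blast
    assume p: "p \<in> polys_upto (Suc k)"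
    then show "0 \<le> riesz y (p * p)" using psd by (simp add: psd_upto_def)
    have "?F (G (?F p)) = ?F p"
      using G(3) p flat_reduction[OF psd _ flat] by simp
    then have "?F (G (?F p) - p) = 0"
      by (simp add: linear_diff[OF linear_moment_map])
    then show "riesz y (r * G (?F p)) = riesz y (r * p)" if "r \<in> polys_upto (Suc k)" for r
      using that by (simp add: moment_map_eq_0_iff right_diff_distrib linear_diff[OF linear_riesz])
    show "G (?F p) = 0" if "\<And>r. r \<in> polys_upto (Suc k) \<Longrightarrow> riesz y (r * p) = 0"
      using that linear_0[OF G(2)] by (simp add: moment_map_eq_0_iff[THEN iffD2])
  qed (rule linear_riesz)
  then show thesis by (rule that)
qed

lemma dim_span_monom: "finite A \<Longrightarrow> dim (span (monomial ` A)) = card A"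
proof -
  assume A: "finite A"
  have inj: "inj_on monomial A"
    by (rule inj_onI) (metis inj_single injD lookup_single_eq lookup_single_not_eq zero_neq_one)
  have "independent (monomial ` A)"
  proof (rule independent_if_scalars_zero)
    fix u x
    assume 0: "(\<Sum>x\<in>monomial ` A. u x *\<^sub>R x) = 0" and "x \<in> monomial ` A"
    then obtain a where a: "a \<in> A" "x = monomial a" by blast
    have "Poly_Mapping.lookup (\<Sum>b\<in>A. u (monomial b) *\<^sub>R monomial b) a = 0"
      using 0 by (simp add: sum.reindex[OF inj])
    then show "u x = 0"
      using a A by (simp add: lookup_sum lookup_single when_def if_distrib cong: if_cong)
  qed (use A in simp)
  then show ?thesis
    by (simp add: dim_eq_card_independent card_image inj)
qed

text \<open>
  Given the atoms, a polynomial of degree at most \<open>k + 1\<close> lies in the kernel iff it vanishes on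
  \<open>G\<close>. By flatness every polynomial is congruent, modulo the ideal generated by the kernel, to one of
  degree at most \<open>k\<close> with the same values on \<open>G\<close>; this gives the ideal of \<open>G\<close> and,
  by interpolation, the rank.
\<close>

theorem flat_extension:
  fixes y :: "'n::finite mexp \<Rightarrow> real"
  assumes psd: "psd_upto (Suc k) y" and flat: "moment_rank (Suc k) y = moment_rank k y"
  obtains G w where "finite G" "\<And>g. g \<in> G \<Longrightarrow> 0 < w g"
    "\<And>p. p \<in> polys_upto (2 * Suc k) \<Longrightarrow> riesz y p = (\<Sum>g\<in>G. w g * poly_eval p g)"
    "vanishing_ideal G = ideal.span (moment_kernel (Suc k) y)"
    "moment_rank (Suc k) y = card G"
    "\<And>p. \<exists>q\<in>polys_upto k. \<forall>g\<in>G. poly_eval q g = poly_eval p g"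
proof -
  let ?K = "moment_kernel (Suc k) y"
  obtain N where "flat_functional (riesz y) k N"
    using flat_normal_form[OF assms] .
  then interpret flat_functional "riesz y" k N .
  obtain G w where G: "finite G" "\<And>g. g \<in> G \<Longrightarrow> 0 < w g"
    and repr: "\<And>p. p \<in> polys_upto (2 * Suc k) \<Longrightarrow> riesz y p = (\<Sum>g\<in>G. w g * poly_eval p g)"
    by (rule flat_atomic) (rule that)
  have mult_upto: "p * q \<in> polys_upto (2 * Suc k)" if "p \<in> polys_upto (Suc k)" "q \<in> polys_upto (Suc k)" for p q :: "'n rpoly"
    using mult_in_polys_upto[OF that] by (simp add: mult_2)
  have kernel: "p \<in> ?K \<longleftrightarrow> (\<forall>g\<in>G. poly_eval p g = 0)" if p: "p \<in> polys_upto (Suc k)" for p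
  proof
    assume "p \<in> ?K"
    then have "(\<Sum>g\<in>G. w g * (poly_eval p g)\<^sup>2) = 0"
      using repr[OF mult_upto[OF p p]] p by (simp add: moment_kernel_eq power2_eq_square)
    then have 0: "w g * (poly_eval p g)\<^sup>2 = 0" if "g \<in> G" for g
      using sum_nonneg_0[OF G(1) _ _ that, of "\<lambda>g. w g * (poly_eval p g)\<^sup>2"] G(2)
      by (simp add: less_imp_le)
    then show "\<forall>g\<in>G. poly_eval p g = 0"
      using G(2) by (metis less_irrefl mult_eq_0_iff zero_eq_power2)
  next
    assume "\<forall>g\<in>G. poly_eval p g = 0"
    then show "p \<in> ?K"
      using repr mult_upto p by (simp add: moment_kernel_eq)
  qed
  have reduce: "\<exists>q\<in>polys_upto k. p - q \<in> ideal.span ?K" for p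
  proof (induction p rule: rpoly_induct)
    case (const c)
    show ?case
      by (rule bexI[of _ "c *\<^sub>R 1"]) (simp_all add: ideal.span_zero subspace_scale)
  next
    case (add p p')
    then obtain q q' where "q \<in> polys_upto k" "p - q \<in> ideal.span ?K"
      "q' \<in> polys_upto k" "p' - q' \<in> ideal.span ?K" by blast
    then show ?case
      using ideal.span_add[of "p - q" ?K "p' - q'"]
      by (intro bexI[of _ "q + q'"]) (simp_all add: algebra_simps subspace_add)
  next
    case (Var_mult i p)
    then obtain q where q: "q \<in> polys_upto k" "p - q \<in> ideal.span ?K" by blast
    obtain q' where q': "q' \<in> polys_upto k" "Var i * q - q' \<in> ?K"
      using flat_reduction_kernel[OF psd _ flat Var_upto[OF q(1)]] by (metis le_Suc_eq le_refl)
    have "Var i * (p - q) + (Var i * q - q') \<in> ideal.span ?K"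
      by (intro ideal.span_add ideal.span_scale ideal.span_base q(2) q'(2))
    then show ?case
      using q'(1) by (intro bexI[of _ q']) (simp_all add: algebra_simps)
  qed
  have "ideal.subspace (vanishing_ideal G)"
    by (auto simp: ideal.subspace_def vanishing_ideal_def)
  moreover have "?K \<subseteq> vanishing_ideal G"
    using kernel by (auto simp: vanishing_ideal_def moment_kernel_eq)
  ultimately have sub: "ideal.span ?K \<subseteq> vanishing_ideal G"
    by (intro ideal.span_minimal)
  have ideal: "vanishing_ideal G = ideal.span ?K"
  proof
    show "vanishing_ideal G \<subseteq> ideal.span ?K"
    proof
      fix p assume p: "p \<in> vanishing_ideal G"
      obtain q where q: "q \<in> polys_upto k" "p - q \<in> ideal.span ?K" using reduce by blast
      then have "\<forall>g\<in>G. poly_eval q g = 0"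
        using p sub by (force simp: vanishing_ideal_def)
      then have "q \<in> ?K" using kernel[OF lower[OF q(1)]] by simp
      then show "p \<in> ideal.span ?K"
        using ideal.span_add[OF q(2) ideal.span_base] by fastforce
    qed
  qed (rule sub)
  have interpolate: "\<exists>q\<in>polys_upto k. \<forall>g\<in>G. poly_eval q g = poly_eval p g" for p
  proof -
    obtain q where q: "q \<in> polys_upto k" "p - q \<in> ideal.span ?K" using reduce by blast
    then have "\<forall>g\<in>G. poly_eval q g = poly_eval p g"
      using sub by (force simp: vanishing_ideal_def)
    then show ?thesis using q(1) by blast
  qed
  \<comment> \<open>Evaluation on \<open>G\<close> has the same kernel as the moment matrix, hence the same rank.\<close>
  define E where "E p = (\<Sum>g\<in>G. Poly_Mapping.single g (poly_eval p g))" for p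
  have lookup_E: "Poly_Mapping.lookup (E p) g = (if g \<in> G then poly_eval p g else 0)" for p g
    using G(1) by (simp add: E_def lookup_sum lookup_single when_def)
  have linE: "linear E"
    by (rule linearI; rule poly_mapping_eqI) (simp_all add: lookup_E lookup_add)
  have "{p \<in> polys_upto (Suc k). E p = 0} = ?K"
    using kernel by (auto simp: poly_mapping_eq_iff fun_eq_iff lookup_E moment_kernel_eq)
  then have "moment_rank (Suc k) y = dim (E ` polys_upto (Suc k))"
    using rank_nullity[OF subspace_polys_upto finite_monoms polys_upto_subset_span linE, of "Suc k"]
      rank_plus_kernel[of "Suc k" y] by simp
  also have "E ` polys_upto (Suc k) = span (monomial ` G)"
  proof
    show "E ` polys_upto (Suc k) \<subseteq> span (monomial ` G)"
      by (auto simp: in_keys_iff lookup_E simp flip: span_monom split: if_splits)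
    have "monomial g \<in> E ` polys_upto (Suc k)" if "g \<in> G" for g
    proof -
      obtain e where e: "\<And>g'. g' \<in> G \<Longrightarrow> poly_eval e g' = (if g' = g then 1 else 0)"
        using interpolation_polynomial[OF G(1)] by blast
      obtain q where q: "q \<in> polys_upto k" "\<forall>g\<in>G. poly_eval q g = poly_eval e g"
        using interpolate by blast
      then have "E q = monomial g"
        using e \<open>g \<in> G\<close> by (intro poly_mapping_eqI) (auto simp: lookup_E lookup_single when_def)
      then show ?thesis using lower[OF q(1)] by (metis image_eqI)
    qed
    then show "span (monomial ` G) \<subseteq> E ` polys_upto (Suc k)"
      by (intro span_minimal linear_subspace_image[OF linE]) auto
  qed
  finally have "moment_rank (Suc k) y = card G"
    by (simp add: dim_span_monom[OF G(1)] del: dim_span)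
  then show thesis using that G repr ideal interpolate by blast
qed

section \<open>Feasible sequences of maximal rank\<close>

lemma total_degree_le_half_deg: "total_degree p \<le> 2 * half_deg p"
  unfolding half_deg_def by linarith

lemma half_deg_le_max: "j \<in> {1..m} \<Longrightarrow> half_deg (h j) \<le> max_half_deg h m"
  unfolding max_half_deg_def by (rule Max_ge) auto

lemma localizer_upto:
  assumes "j \<in> {1..m}" "max_half_deg h m \<le> t" "p \<in> polys_upto (2 * (t - half_deg (h j)))"
  shows "p * h j \<in> polys_upto (2 * t)"
proof -
  have "h j \<in> polys_upto (2 * half_deg (h j))"
    using polys_upto_total_degree polys_upto_mono[OF total_degree_le_half_deg] by blast
  from mult_in_polys_upto[OF assms(3) this]
  have "p * h j \<in> polys_upto (2 * (t - half_deg (h j)) + 2 * half_deg (h j))" .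
  moreover have "2 * (t - half_deg (h j)) + 2 * half_deg (h j) = 2 * t"
    using half_deg_le_max[OF assms(1), of h] assms(2) by simp
  ultimately show ?thesis by simp
qed

lemma moment_feasible_iff:
  "y \<in> moment_feasible h m t \<longleftrightarrow> y \<in> mexps (2 * t) \<rightarrow>\<^sub>E UNIV \<and> y 0 = 1 \<and> psd_upto t y \<and>
    (\<forall>j\<in>{1..m}. \<forall>p\<in>polys_upto (2 * (t - half_deg (h j))). riesz y (p * h j) = 0)"
  by (simp add: moment_feasible_def psd_on_moment_entry psd_upto_def zero_on_localizing)

lemma riesz_restrict:
  "p \<in> polys_upto (2 * t) \<Longrightarrow> riesz (restrict y (mexps (2 * t))) p = riesz y p"
  by (rule riesz_cong) auto

text \<open>
  Feasible sequences are \<open>undefined\<close> beyond degree \<open>2 t\<close>; sequences given by a formula have to be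
  restricted first.
\<close>

lemma restrict_feasible:
  fixes h :: "nat \<Rightarrow> 'n::finite rpoly"
  assumes "y 0 = 1" "psd_upto t y" "max_half_deg h m \<le> t"
    and "\<And>j p. j \<in> {1..m} \<Longrightarrow> p \<in> polys_upto (2 * (t - half_deg (h j))) \<Longrightarrow> riesz y (p * h j) = 0"
  shows "restrict y (mexps (2 * t)) \<in> moment_feasible h m t"
  unfolding moment_feasible_iff psd_upto_def
proof (intro conjI ballI)
  fix p :: "'n rpoly" assume "p \<in> polys_upto t"
  then show "0 \<le> riesz (restrict y (mexps (2 * t))) (p * p)"
    using assms(2) square_in_polys_upto[of p t] by (simp add: riesz_restrict psd_upto_def)
next
  fix j and p :: "'n rpoly" assume "j \<in> {1..m}" "p \<in> polys_upto (2 * (t - half_deg (h j)))"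
  then show "riesz (restrict y (mexps (2 * t))) (p * h j) = 0"
    using assms(4) localizer_upto[OF _ assms(3)] by (simp add: riesz_restrict)
qed (use assms(1) in auto)

lemma subspace_moment_kernel: "subspace (moment_kernel s y)"
  using subspace_kernel_on[OF subspace_polys_upto linear_moment_map, of s s y]
  by (simp add: moment_kernel_eq moment_map_eq_0_iff)

text \<open>
  The kernel at the midpoint of \<open>y\<close> and \<open>z\<close> is the intersection of their kernels, as both quadratic forms
  are nonnegative. The rank of \<open>y\<close> being maximal, this intersection cannot be smaller than the kernel of \<open>y\<close>.
\<close>

lemma max_rank_kernel_subset:
  fixes h :: "nat \<Rightarrow> 'n::finite rpoly"
  assumes d: "max_half_deg h m \<le> t" and y: "y \<in> moment_feasible h m t" and z: "z \<in> moment_feasible h m t"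
    and max_rank: "\<forall>z\<in>moment_feasible h m t. moment_rank t z \<le> moment_rank t y"
  shows "moment_kernel t y \<subseteq> moment_kernel t z"
proof -
  let ?v = "\<lambda>\<alpha>. (y \<alpha> + z \<alpha>) / 2"
  define u where "u = restrict ?v (mexps (2 * t))"
  have v: "riesz ?v p = (riesz y p + riesz z p) / 2" for p
    by (simp add: lin_ext_def sum.distrib algebra_simps add_divide_distrib sum_divide_distrib)
  have u: "u \<in> moment_feasible h m t"
    unfolding u_def
    by (rule restrict_feasible) (use y z d in \<open>auto simp: moment_feasible_iff psd_upto_def v\<close>)
  have psd: "psd_upto t y" "psd_upto t z" using y z by (auto simp: moment_feasible_iff)
  have sub: "p \<in> moment_kernel t y" "p \<in> moment_kernel t z" if p: "p \<in> moment_kernel t u" for p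
  proof -
    have up: "p \<in> polys_upto t" "p * p \<in> polys_upto (2 * t)" and "riesz u (p * p) = 0"
      using p square_in_polys_upto[of p t] by (auto simp: moment_kernel_eq)
    then have "riesz y (p * p) + riesz z (p * p) = 0"
      by (simp add: u_def riesz_restrict v)
    moreover have "0 \<le> riesz y (p * p)" "0 \<le> riesz z (p * p)"
      using psd up(1) by (auto simp: psd_upto_def)
    ultimately have "riesz y (p * p) = 0" "riesz z (p * p) = 0" by linarith+
    then show "p \<in> moment_kernel t y" "p \<in> moment_kernel t z"
      using moment_kernelI_psd psd up(1) by blast+
  qed
  have span: "moment_kernel t y \<subseteq> span (monomial ` mexps t)"
    by (auto simp: moment_kernel_eq simp flip: polys_upto_span)
  have fin: "finite (monomial ` mexps t :: 'n rpoly set)"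
    by (rule finite_monoms)
  have "moment_rank t u \<le> moment_rank t y" using max_rank u by blast
  then have "dim (moment_kernel t y) \<le> dim (moment_kernel t u)"
    using rank_plus_kernel[of t u] rank_plus_kernel[of t y] by linarith
  moreover have "dim (moment_kernel t u) \<le> dim (moment_kernel t y)"
    by (rule dim_mono_finite[OF _ fin span]) (use sub in blast)
  ultimately have "moment_kernel t u = moment_kernel t y"
    by (intro subspace_eqI_dim[OF subspace_moment_kernel subspace_moment_kernel _ fin span])
      (use sub in auto)
  then show ?thesis using sub by blast
qed

lemma real_variety_span: "real_variety (ideal.span (h ` {1..m})) = {x. \<forall>j\<in>{1..m}. poly_eval (h j) x = 0}"
proof
  show "{x. \<forall>j\<in>{1..m}. poly_eval (h j) x = 0} \<subseteq> real_variety (ideal.span (h ` {1..m}))"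
  proof
    fix x assume "x \<in> {x. \<forall>j\<in>{1..m}. poly_eval (h j) x = 0}"
    then have "h ` {1..m} \<subseteq> vanishing_ideal {x}" by (auto simp: vanishing_ideal_def)
    moreover have "ideal.subspace (vanishing_ideal {x})"
      by (auto simp: ideal.subspace_def vanishing_ideal_def)
    ultimately have "ideal.span (h ` {1..m}) \<subseteq> vanishing_ideal {x}"
      by (rule ideal.span_minimal)
    then show "x \<in> real_variety (ideal.span (h ` {1..m}))"
      by (auto simp: real_variety_def vanishing_ideal_def)
  qed
qed (auto simp: real_variety_def ideal.span_base)

lemma max_rank_kernel_vanishes:
  fixes h :: "nat \<Rightarrow> 'n::finite rpoly"
  assumes d: "max_half_deg h m \<le> t" and y: "y \<in> moment_feasible h m t"
    and max_rank: "\<forall>z\<in>moment_feasible h m t. moment_rank t z \<le> moment_rank t y"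
    and x: "\<And>j. j \<in> {1..m} \<Longrightarrow> poly_eval (h j) x = 0" and p: "p \<in> moment_kernel t y"
  shows "poly_eval p x = 0"
proof -
  define z where "z = restrict (monom_eval x) (mexps (2 * t))"
  have "z \<in> moment_feasible h m t"
    unfolding z_def
    by (rule restrict_feasible)
      (use d x in \<open>auto simp: psd_upto_def monom_eval_def simp flip: poly_eval_lin_ext\<close>)
  then have "p \<in> moment_kernel t z"
    using max_rank_kernel_subset[OF d y _ max_rank] p by blast
  then have "p \<in> polys_upto t" "riesz z (p * p) = 0" by (auto simp: moment_kernel_eq)
  then show ?thesis
    using square_in_polys_upto[of p t]
    by (simp add: z_def riesz_restrict flip: poly_eval_lin_ext)
qed

text \<open>
  If all \<open>h j\<close> are constants, then \<open>h j y = 0\<close> together with \<open>y 0 = 1\<close> forces \<open>h j = 0\<close>, and every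
  point lies in the variety.
\<close>

lemma max_half_deg_pos:
  fixes h :: "nat \<Rightarrow> 'n::finite rpoly"
  assumes y: "y \<in> moment_feasible h m t" and fin: "finite {x. \<forall>j\<in>{1..m}. poly_eval (h j) x = 0}"
  shows "0 < max_half_deg h m"
proof (rule ccontr)
  assume "\<not> 0 < max_half_deg h m"
  then have "h j = 0" if j: "j \<in> {1..m}" for j
  proof -
    have "h j \<in> polys_upto 0"
      using half_deg_le_max[OF j, of h] total_degree_le_half_deg[of "h j"] polys_upto_total_degree[of "h j"]
        \<open>\<not> 0 < max_half_deg h m\<close> by simp
    moreover have "mexps 0 = {0 :: 'n mexp}"
      by (auto simp: mexps_def mdeg_def intro: poly_mapping_eqI)
    ultimately have keys: "Poly_Mapping.keys (h j) \<subseteq> {0}" by (simp add: polys_upto_def)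
    have "riesz y (1 * h j) = 0"
      using y j one_in_polys_upto unfolding moment_feasible_iff by blast
    then have "Poly_Mapping.lookup (h j) 0 = 0"
      using y lin_ext_superset[OF _ keys, of y] by (simp add: moment_feasible_iff)
    then show "h j = 0" using keys by (auto simp: in_keys_iff intro!: poly_mapping_eqI)
  qed
  then have "{x. \<forall>j\<in>{1..m}. poly_eval (h j) x = 0} = UNIV" by auto
  then have "finite (UNIV :: (real ^ 'n) set)"
    using fin by simp
  then have "bounded (UNIV :: (real ^ 'n) set)"
    by (rule finite_imp_bounded)
  then show False by simp
qed

section \<open>The variety and the kernel of a flat moment matrix\<close>

theorem proposition4p4:
  fixes h :: "nat \<Rightarrow> 'n::finite rpoly"
    and m t s :: nat
    and I :: "'n rpoly set"
    and y :: "'n mexp \<Rightarrow> real"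
  defines "d \<equiv> max_half_deg h m"
  assumes I: "I = ideal.span (h ` {1..m})"
    and finite_variety: "finite (real_variety I)"
    and t: "t \<ge> d"
    and y: "y \<in> moment_feasible h m t"
    and max_rank: "\<forall>z\<in>moment_feasible h m t. moment_rank t z \<le> moment_rank t y"
    and flat: "(s \<ge> 1 \<and> 2 * d \<le> s \<and> s \<le> t \<and> moment_rank s y = moment_rank (s - 1) y) \<or>
               (d \<le> s \<and> s \<le> t \<and> moment_rank s y = moment_rank (s - d) y)"
  shows "vanishing_ideal (real_variety I) = ideal.span (moment_kernel s y) \<and>
         moment_rank s y = card (real_variety I)"
proof -
  have V: "real_variety I = {x. \<forall>j\<in>{1..m}. poly_eval (h j) x = 0}"
    unfolding I by (rule real_variety_span)
  have "0 < d"
    using max_half_deg_pos[OF y] finite_variety unfolding V d_def by blast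
  have "s \<le> t" using flat by blast
  have psd_t: "psd_upto t y"
    and loc: "\<And>j p. j \<in> {1..m} \<Longrightarrow> p \<in> polys_upto (2 * (t - half_deg (h j))) \<Longrightarrow> riesz y (p * h j) = 0"
    using y by (auto simp: moment_feasible_iff)
  have psd: "psd_upto s y" by (rule psd_upto_mono[OF psd_t \<open>s \<le> t\<close>])
  have hd: "half_deg (h j) \<le> d" if "j \<in> {1..m}" for j
    unfolding d_def by (rule half_deg_le_max[OF that])
  have hup: "h j \<in> polys_upto (2 * d)" if "j \<in> {1..m}" for j
    using polys_upto_total_degree[of "h j"] total_degree_le_half_deg[of "h j"] hd[OF that]
      polys_upto_mono[of "total_degree (h j)" "2 * d"] by auto
  obtain k where s: "s = Suc k" using flat \<open>0 < d\<close> by (cases s) auto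
  have rank: "moment_rank (Suc k) y = moment_rank k y"
  proof -
    have "moment_rank s y = moment_rank (s - 1) y"
      if "moment_rank s y = moment_rank (s - d) y"
      using moment_rank_mono[of "s - 1" y "s - d"] moment_rank_mono[OF psd, of "s - 1"]
        psd_upto_mono[OF psd, of "s - 1"] \<open>0 < d\<close> that by simp
    then show ?thesis using flat s by auto
  qed
  obtain G w where G: "finite G" "\<And>g. g \<in> G \<Longrightarrow> 0 < w g"
    and repr: "\<And>p. p \<in> polys_upto (2 * s) \<Longrightarrow> riesz y p = (\<Sum>g\<in>G. w g * poly_eval p g)"
    and ideal: "vanishing_ideal G = ideal.span (moment_kernel s y)"
    and card: "moment_rank s y = card G"
    and interpolate: "\<And>p. \<exists>q\<in>polys_upto k. \<forall>g\<in>G. poly_eval q g = poly_eval p g"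
    using flat_extension[OF psd[unfolded s] rank] unfolding s by blast
  have "G \<subseteq> real_variety I"
  proof (clarsimp simp: V)
    fix g j assume g: "g \<in> G" and j: "Suc 0 \<le> j" "j \<le> m"
    then have j: "j \<in> {1..m}" by simp
    from flat show "poly_eval (h j) g = 0"
    proof (elim disjE conjE)
      \<comment> \<open>All \<open>h j\<close> have degree at most \<open>s\<close>, and \<open>L\<close> kills their multiples up to the needed degree.\<close>
      assume s2: "2 * d \<le> s"
      have "s \<le> 2 * (t - half_deg (h j))"
        using hd[OF j] s2 \<open>s \<le> t\<close> by linarith
      then have "h j \<in> moment_kernel s y"
        using hup[OF j] polys_upto_mono[OF s2] loc[OF j] polys_upto_mono[of s "2 * (t - half_deg (h j))"]
        by (auto simp: moment_kernel_eq)
      then have "h j \<in> vanishing_ideal G"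
        unfolding ideal by (rule ideal.span_base)
      then show ?thesis using g by (simp add: vanishing_ideal_def)
    next
      \<comment> \<open>Test the localizing condition on the square of an interpolation polynomial for \<open>g\<close>,
        reduced to degree at most \<open>s - d\<close>.\<close>
      assume ds: "d \<le> s" and rk: "moment_rank s y = moment_rank (s - d) y"
      obtain e where e: "\<And>g'. g' \<in> G \<Longrightarrow> poly_eval e g' = (if g' = g then 1 else 0)"
        using interpolation_polynomial[OF G(1)] by blast
      obtain q where q: "q \<in> polys_upto k" "\<forall>g'\<in>G. poly_eval q g' = poly_eval e g'"
        using interpolate by blast
      have "q \<in> polys_upto s" using q(1) polys_upto_mono[of k s] s by auto
      then obtain r where r: "r \<in> polys_upto (s - d)" "q - r \<in> moment_kernel s y"
        using flat_reduction_kernel[OF psd _ rk] by (metis diff_le_self)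
      have "q - r \<in> vanishing_ideal G"
        unfolding ideal using r(2) by (rule ideal.span_base)
      then have val: "poly_eval r g' = (if g' = g then 1 else 0)" if "g' \<in> G" for g'
        using that q(2) e by (force simp: vanishing_ideal_def)
      have rr: "r * r \<in> polys_upto (2 * (s - d))"
        by (rule square_in_polys_upto[OF r(1)])
      have "r * r * h j \<in> polys_upto (2 * (s - d) + 2 * d)"
        by (rule mult_in_polys_upto[OF rr hup[OF j]])
      then have "r * r * h j \<in> polys_upto (2 * s)" using ds by (simp add: algebra_simps)
      then have "riesz y (r * r * h j) = (\<Sum>g'\<in>G. if g' = g then w g * poly_eval (h j) g else 0)"
        using repr val by (auto intro!: sum.cong)
      moreover have "2 * (s - d) \<le> 2 * (t - half_deg (h j))"
        using hd[OF j] \<open>s \<le> t\<close> by linarith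
      then have "riesz y (r * r * h j) = 0"
        using loc[OF j] rr polys_upto_mono by blast
      ultimately have "w g * poly_eval (h j) g = 0" using G(1) g by simp
      then show ?thesis using G(2)[OF g] by simp
    qed
  qed
  moreover have "real_variety I \<subseteq> G"
  proof
    fix x assume x: "x \<in> real_variety I"
    have "moment_kernel s y \<subseteq> vanishing_ideal {x}"
    proof
      fix p assume "p \<in> moment_kernel s y"
      then have "p \<in> moment_kernel t y" using moment_kernel_mono[OF psd_t \<open>s \<le> t\<close>] by blast
      then show "p \<in> vanishing_ideal {x}"
        using max_rank_kernel_vanishes[OF t[unfolded d_def] y max_rank] x
        by (simp add: V vanishing_ideal_def)
    qed
    then have "vanishing_ideal G \<subseteq> vanishing_ideal {x}"
      unfolding ideal by (rule ideal.span_minimal) (auto simp: ideal.subspace_def vanishing_ideal_def)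
    obtain e where e: "\<And>g. g \<in> insert x G \<Longrightarrow> poly_eval e g = (if g = x then 1 else 0)"
      using interpolation_polynomial[of "insert x G"] G(1) by blast
    show "x \<in> G"
    proof (rule ccontr)
      assume "x \<notin> G"
      then have "e \<in> vanishing_ideal G" using e by (auto simp: vanishing_ideal_def)
      then show False
        using \<open>vanishing_ideal G \<subseteq> vanishing_ideal {x}\<close> e[of x] by (auto simp: vanishing_ideal_def)
    qed
  qed
  ultimately have "G = real_variety I" by blast
  then show ?thesis using ideal card by simp
qed

end
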